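(* Let $d\ge 3$ be odd and let $\pmb{\lambda}$ be a $d$-tuple of partitions of the same integer $m\le 2^{d-1}$, with all parts at most $2$. For an integer $\ell$ let $V_\ell=(\mathbb{C}^\ell)^{\otimes d}$. Then for each integer $\ell>2$ the map $$L:\ \mathrm{HWV}_{\pmb{\lambda}'}\bigwedge V_\ell\longrightarrow\mathrm{HWV}_{(\rho_\ell\pmb{\lambda})'}\bigwedge V_\ell,\qquad L(v)=\omega_{d,\ell}\wedge v,$$ is injective. In particular, $g(\pmb{\lambda})\le g(\rho_\ell\,\pmb{\lambda})$.
   Context: For partitions $\mu^{(1)},\ldots,\mu^{(d)}$ of the same integer $N$, the (generalized) Kronecker coefficient $g(\mu^{(1)},\ldots,\mu^{(d)})$ is the multiplicity of the trivial representation $[(N)]$ in $[\mu^{(1)}]\otimes\cdots\otimes[\mu^{(d)}]$, where $[\mu]$ is the irreducible complex representation of $S_N$ indexed by $\mu$. $\lambda'$ denotes the conjugate partition (componentwise on tuples). For a partition $\lambda$ with parts at most $\ell$, $\rho_\ell\lambda=(\ell,\lambda_1,\lambda_2,\ldots)$ adds a first part equal to $\ell$; on tuples it acts componentwise. The group $\mathrm{GL}(\ell)^{\times d}$ acts on $V_\ell$ multilinearly and hence on $\bigwedge V_\ell$. A vector $v\in\bigwedge V_\ell$ is a weight vector of weight $\pmb{\mu}=(\mu^{(1)},\ldots,\mu^{(d)})$, $\mu^{(j)}\in\mathbb{Z}^\ell$, if every tuple of diagonal matrices $(\mathrm{diag}(a^{(1)}_1,\ldots,a^{(1)}_\ell),\ldots,\mathrm{diag}(a^{(d)}_1,\ldots,a^{(d)}_\ell))$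 acts on $v$ as the scalar $\prod_j\prod_i (a^{(j)}_i)^{\mu^{(j)}_i}$. $\mathrm{HWV}_{\pmb{\mu}}\bigwedge V_\ell$ is the space consisting of $0$ and the nonzero weight vectors of weight $\pmb{\mu}$ invariant under $U(\ell)^{\times d}$, with $U(\ell)$ the group of upper unitriangular matrices. Partitions of length at most $\ell$ are padded with zeros to vectors in $\mathbb{Z}^\ell$. The Cayley form is $$\omega_{d,\ell}=\sum_{\pi_1,\ldots,\pi_d\in S_\ell}\mathrm{sgn}(\pi_1\cdots\pi_d)\bigwedge_{i=1}^\ell \left(e_{\pi_1(i)}\otimes\cdots\otimes e_{\pi_d(i)}\right)\in\bigwedge^\ell V_\ell,$$ where $e_1,\ldots,e_\ell$ is the standard basis of $\mathbb{C}^\ell$. *)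

theory Defs
  imports
    "HOL-Library.Function_Algebras"
    "HOL-Library.FuncSet"
    "HOL-Combinatorics.Permutations"
    "Jordan_Normal_Form.Matrix"
begin

section \<open>Complex function spaces\<close>

definition fscale :: "complex \<Rightarrow> ('a \<Rightarrow> complex) \<Rightarrow> 'a \<Rightarrow> complex" where
  "fscale c f = (\<lambda>x. c * f x)"

interpretation fun_space: vector_space "fscale :: complex \<Rightarrow> ('a \<Rightarrow> complex) \<Rightarrow> 'a \<Rightarrow> complex"
  by unfold_locales (auto simp: fscale_def fun_eq_iff algebra_simps)

definition mscale :: "complex \<Rightarrow> ('b \<Rightarrow> 'a \<Rightarrow> complex) \<Rightarrow> 'b \<Rightarrow> 'a \<Rightarrow> complex" where
  "mscale c F = (\<lambda>x. fscale c (F x))"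

interpretation map_space:
  vector_space "mscale :: complex \<Rightarrow> ('b \<Rightarrow> 'a \<Rightarrow> complex) \<Rightarrow> 'b \<Rightarrow> 'a \<Rightarrow> complex"
  by unfold_locales (auto simp: mscale_def fscale_def fun_eq_iff algebra_simps)

definition delta :: "'a \<Rightarrow> 'a \<Rightarrow> complex" where
  "delta x = (\<lambda>y. if y = x then 1 else 0)"

text \<open>A tensor product of spaces of functions on \<open>X\<^sub>0, \<dots>, X\<^sub>d\<^sub>-\<^sub>1\<close> is a space of functions on
  \<open>X\<^sub>0 \<times> \<dots> \<times> X\<^sub>d\<^sub>-\<^sub>1\<close>, whose elements are represented by lists of length \<open>d\<close>.\<close>

definition pure_tensor :: "('a \<Rightarrow> complex) list \<Rightarrow> 'a list \<Rightarrow> complex" where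
  "pure_tensor fs = (\<lambda>xs. if length xs = length fs
     then (\<Prod>j<length fs. (fs ! j) (xs ! j)) else 0)"

definition tensor_space :: "('a \<Rightarrow> complex) set list \<Rightarrow> ('a list \<Rightarrow> complex) set" where
  "tensor_space Ws = fun_space.span
     {pure_tensor fs | fs. length fs = length Ws \<and> (\<forall>j<length Ws. fs ! j \<in> Ws ! j)}"


section \<open>Partitions\<close>

definition is_partition :: "nat \<Rightarrow> nat list \<Rightarrow> bool" where
  "is_partition n p \<longleftrightarrow> sorted_wrt (\<ge>) p \<and> 0 \<notin> set p \<and> sum_list p = n"

definition conj_partition :: "nat list \<Rightarrow> nat list" where
  "conj_partition p =
     map (\<lambda>c. length (filter (\<lambda>x. c < x) p)) [0..<(case p of [] \<Rightarrow> 0 | x # _ \<Rightarrow> x)]"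

definition rho :: "nat \<Rightarrow> nat list \<Rightarrow> nat list" where
  "rho l p = l # p"

definition one_row :: "nat \<Rightarrow> nat list" where
  "one_row n = (if n = 0 then [] else [n])"


section \<open>Irreducible representations of symmetric groups\<close>

text \<open>\<open>S\<^sub>n\<close> is the group of permutations of \<open>{..<n}\<close>. The irreducible representation \<open>[p]\<close> is the
  Specht module. A tableau maps each entry to its box. A tabloid (row equivalence class) is
  encoded as the list whose \<open>k\<close>-th member is the row of the entry \<open>k\<close>, so that \<open>\<pi>\<close> sends the
  tabloid \<open>t\<close> to \<open>permute_list (inv \<pi>) t\<close>; on functions this is the action \<open>tabloid_act\<close>.\<close>

definition diagram :: "nat list \<Rightarrow> (nat \<times> nat) set" where
  "diagram p = {(r, c). r < length p \<and> c < p ! r}"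

definition tableaux :: "nat list \<Rightarrow> (nat \<Rightarrow> nat \<times> nat) set" where
  "tableaux p = {T. bij_betw T {..<sum_list p} (diagram p)}"

definition tabloid :: "nat list \<Rightarrow> (nat \<Rightarrow> nat \<times> nat) \<Rightarrow> nat list" where
  "tabloid p T = map (\<lambda>k. fst (T k)) [0..<sum_list p]"

definition column_stabilizer :: "nat list \<Rightarrow> (nat \<Rightarrow> nat \<times> nat) \<Rightarrow> (nat \<Rightarrow> nat) set" where
  "column_stabilizer p T =
     {\<sigma>. \<sigma> permutes {..<sum_list p} \<and> (\<forall>k<sum_list p. snd (T (\<sigma> k)) = snd (T k))}"

definition tabloid_act :: "(nat \<Rightarrow> nat) \<Rightarrow> (nat list \<Rightarrow> complex) \<Rightarrow> nat list \<Rightarrow> complex" where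
  "tabloid_act \<pi> f = (\<lambda>t. f (permute_list \<pi> t))"

definition polytabloid :: "nat list \<Rightarrow> (nat \<Rightarrow> nat \<times> nat) \<Rightarrow> nat list \<Rightarrow> complex" where
  "polytabloid p T = (\<Sum>\<sigma>\<in>column_stabilizer p T.
     fscale (of_int (sign \<sigma>)) (tabloid_act \<sigma> (delta (tabloid p T))))"

definition specht :: "nat list \<Rightarrow> (nat list \<Rightarrow> complex) set" where
  "specht p = fun_space.span (polytabloid p ` tableaux p)"

definition diagonal_act ::
    "(nat \<Rightarrow> nat) \<Rightarrow> (nat list list \<Rightarrow> complex) \<Rightarrow> nat list list \<Rightarrow> complex" where
  "diagonal_act \<pi> f = (\<lambda>ts. f (map (permute_list \<pi>) ts))"

text \<open>Equivariant linear maps between two representations \<open>(W, \<alpha>)\<close> and \<open>(X, \<beta>)\<close> of \<open>S\<^sub>n\<close>; they are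
  set to \<open>0\<close> outside \<open>W\<close>, so that a map is determined by its restriction to \<open>W\<close>.\<close>

definition equivariant_maps ::
    "nat \<Rightarrow> ('a \<Rightarrow> complex) set \<Rightarrow> ((nat \<Rightarrow> nat) \<Rightarrow> ('a \<Rightarrow> complex) \<Rightarrow> 'a \<Rightarrow> complex)
     \<Rightarrow> ('b \<Rightarrow> complex) set \<Rightarrow> ((nat \<Rightarrow> nat) \<Rightarrow> ('b \<Rightarrow> complex) \<Rightarrow> 'b \<Rightarrow> complex)
     \<Rightarrow> (('a \<Rightarrow> complex) \<Rightarrow> 'b \<Rightarrow> complex) set" where
  "equivariant_maps n W \<alpha> X \<beta> = {F.
     (\<forall>x\<in>W. F x \<in> X) \<and> (\<forall>x. x \<notin> W \<longrightarrow> F x = 0) \<and>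
     (\<forall>x\<in>W. \<forall>y\<in>W. F (x + y) = F x + F y) \<and>
     (\<forall>c. \<forall>x\<in>W. F (fscale c x) = fscale c (F x)) \<and>
     (\<forall>\<pi>. \<pi> permutes {..<n} \<longrightarrow> (\<forall>x\<in>W. F (\<alpha> \<pi> x) = \<beta> \<pi> (F x)))}"

text \<open>The multiplicity of an irreducible representation \<open>W\<close> in \<open>X\<close> is \<open>dim Hom(W, X)\<close>.\<close>

definition multiplicity_in ::
    "nat \<Rightarrow> ('a \<Rightarrow> complex) set \<Rightarrow> ((nat \<Rightarrow> nat) \<Rightarrow> ('a \<Rightarrow> complex) \<Rightarrow> 'a \<Rightarrow> complex)
     \<Rightarrow> ('b \<Rightarrow> complex) set \<Rightarrow> ((nat \<Rightarrow> nat) \<Rightarrow> ('b \<Rightarrow> complex) \<Rightarrow> 'b \<Rightarrow> complex) \<Rightarrow> nat" where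
  "multiplicity_in n W \<alpha> X \<beta> = map_space.dim (equivariant_maps n W \<alpha> X \<beta>)"

definition kronecker :: "nat \<Rightarrow> nat list list \<Rightarrow> nat" where
  "kronecker n ps = multiplicity_in n (specht (one_row n)) tabloid_act
     (tensor_space (map specht ps)) diagonal_act"


section \<open>The exterior algebra of \<open>V\<^sub>l\<close>\<close>

text \<open>Tensor factors and coordinates are numbered from \<open>0\<close>. The standard basis of
  \<open>V\<^sub>l = (\<complex>\<^sup>l)\<^sup>\<otimes>\<^sup>d\<close> is indexed by \<open>multi_index d l\<close>. The exterior algebra of \<open>V\<^sub>l\<close> is realised as
  the algebra of alternating tensors: an element assigns to every word \<open>w\<close> in the multi-indices
  its coefficient in the tensor power of degree \<open>length w\<close>. Degrees above \<open>dim V\<^sub>l\<close> vanish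
  automatically, as alternating functions vanish on words with a repeated letter.\<close>

definition multi_index :: "nat \<Rightarrow> nat \<Rightarrow> nat list set" where
  "multi_index d l = {b. length b = d \<and> set b \<subseteq> {..<l}}"

definition ext_alg :: "nat \<Rightarrow> nat \<Rightarrow> (nat list list \<Rightarrow> complex) set" where
  "ext_alg d l = {f.
     (\<forall>w. \<not> set w \<subseteq> multi_index d l \<longrightarrow> f w = 0) \<and>
     (\<forall>w \<pi>. \<pi> permutes {..<length w} \<longrightarrow> f (permute_list \<pi> w) = of_int (sign \<pi>) * f w)}"

text \<open>The exterior product of alternating tensors, in the determinant normalisation: a sum over
  the ways to split the positions of a word into a part for \<open>f\<close> and a part for \<open>g\<close>, with the sign
  of the corresponding shuffle. Thus \<open>x\<^sub>1 \<and> \<dots> \<and> x\<^sub>k\<close> is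
  \<open>\<Sum>\<^sub>\<sigma> sgn(\<sigma>) x\<^sub>\<sigma>\<^sub>(\<^sub>1\<^sub>) \<otimes> \<dots> \<otimes> x\<^sub>\<sigma>\<^sub>(\<^sub>k\<^sub>)\<close> for vectors \<open>x\<^sub>i\<close>.\<close>

definition shuffle_sign :: "nat \<Rightarrow> nat set \<Rightarrow> complex" where
  "shuffle_sign n I = (-1) ^ card {(i, j). i \<in> {..<n} - I \<and> j \<in> I \<and> i < j}"

definition wedge :: "(nat list list \<Rightarrow> complex) \<Rightarrow> (nat list list \<Rightarrow> complex)
    \<Rightarrow> nat list list \<Rightarrow> complex" where
  "wedge f g = (\<lambda>w. \<Sum>I\<in>Pow {..<length w}.
     shuffle_sign (length w) I * f (nths w I) * g (nths w ({..<length w} - I)))"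

definition ext_vec :: "(nat list \<Rightarrow> complex) \<Rightarrow> nat list list \<Rightarrow> complex" where
  "ext_vec x = (\<lambda>w. case w of [b] \<Rightarrow> x b | _ \<Rightarrow> 0)"

definition wedge_vecs :: "(nat list \<Rightarrow> complex) list \<Rightarrow> nat list list \<Rightarrow> complex" where
  "wedge_vecs xs = foldr wedge (map ext_vec xs) (delta [])"

text \<open>\<open>tensor_entry As\<close> is the matrix of \<open>A\<^sub>0 \<otimes> \<dots> \<otimes> A\<^sub>d\<^sub>-\<^sub>1\<close> acting on \<open>V\<^sub>l\<close>. A tuple \<open>As\<close> acts on
  words of length \<open>k\<close> by the \<open>k\<close>-th tensor power of this matrix.\<close>

definition tensor_entry :: "complex mat list \<Rightarrow> nat list \<Rightarrow> nat list \<Rightarrow> complex" where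
  "tensor_entry As b c = (\<Prod>j<length As. (As ! j) $$ (b ! j, c ! j))"

definition ext_act :: "nat \<Rightarrow> nat \<Rightarrow> complex mat list \<Rightarrow> (nat list list \<Rightarrow> complex)
    \<Rightarrow> nat list list \<Rightarrow> complex" where
  "ext_act d l As f = (\<lambda>w. if set w \<subseteq> multi_index d l
     then \<Sum>u\<in>{u. length u = length w \<and> set u \<subseteq> multi_index d l}.
       (\<Prod>k<length w. tensor_entry As (w ! k) (u ! k)) * f u
     else 0)"


section \<open>Highest weight vectors and the Cayley form\<close>

definition weight_vector ::
    "nat \<Rightarrow> nat \<Rightarrow> (nat \<Rightarrow> nat \<Rightarrow> int) \<Rightarrow> (nat list list \<Rightarrow> complex) \<Rightarrow> bool" where
  "weight_vector d l mu v \<longleftrightarrow>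
     (\<forall>a :: nat \<Rightarrow> nat \<Rightarrow> complex. (\<forall>j<d. \<forall>i<l. a j i \<noteq> 0) \<longrightarrow>
        ext_act d l (map (\<lambda>j. mat_diag l (a j)) [0..<d]) v
          = fscale (\<Prod>j<d. \<Prod>i<l. a j i powi mu j i) v)"

definition upper_unitriangular :: "nat \<Rightarrow> complex mat set" where
  "upper_unitriangular l =
     {A. A \<in> carrier_mat l l \<and> upper_triangular A \<and> (\<forall>i<l. A $$ (i, i) = 1)}"

definition HWV :: "nat \<Rightarrow> nat \<Rightarrow> (nat \<Rightarrow> nat \<Rightarrow> int) \<Rightarrow> (nat list list \<Rightarrow> complex) set" where
  "HWV d l mu = {v \<in> ext_alg d l. weight_vector d l mu v \<and>
     (\<forall>As. length As = d \<and> set As \<subseteq> upper_unitriangular l \<longrightarrow> ext_act d l As v = v)}"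

text \<open>The weight of a tuple of partitions, padded with zeros.\<close>

definition weight_of :: "nat list list \<Rightarrow> nat \<Rightarrow> nat \<Rightarrow> int" where
  "weight_of ps j i = (if i < length (ps ! j) then int (ps ! j ! i) else 0)"

definition cayley :: "nat \<Rightarrow> nat \<Rightarrow> nat list list \<Rightarrow> complex" where
  "cayley d l = (\<Sum>\<pi>s\<in>{\<pi>s. length \<pi>s = d \<and> (\<forall>\<pi>\<in>set \<pi>s. \<pi> permutes {..<l})}.
     fscale (of_int (sign (foldr (\<circ>) \<pi>s id)))
       (wedge_vecs (map (\<lambda>i. pure_tensor (map (\<lambda>\<pi>. delta (\<pi> i)) \<pi>s)) [0..<l])))"

end

theory Submission
  imports Defs "HOL-Library.Product_Lexorder" "Jordan_Normal_Form.Determinant"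
begin

text \<open>The highest weight vectors of weight \<open>\<lambda>'\<close> lie in the exterior algebra of \<open>V\<^sub>2\<close>, because the
  conjugate partitions have at most two parts. For \<open>l > 2\<close> the Cayley form has a term \<open>e\<close> none of
  whose factors lies in \<open>V\<^sub>2\<close>, and for odd \<open>d\<close> the contributions to its coefficient do not cancel.
  So the part of \<open>\<omega> \<and> v\<close> that lies in \<open>e \<and> \<And> V\<^sub>2\<close> is a nonzero multiple of \<open>e \<and> v\<close>, and
  it determines \<open>v\<close>.

  For the Kronecker coefficients, let \<open>D\<^sub>p(r, c)\<close> be the sign of the reading word of the tableau of
  shape \<open>p\<close> with row word \<open>r\<close> and column word \<open>c\<close>, or \<open>0\<close> if there is none. The columns of the
  real matrix \<open>D\<^sub>p\<close> are the polytabloids up to sign, so the Specht module is its column space. With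
  \<open>D\<close> and \<open>D'\<close> the tensor products of these matrices for \<open>\<lambda>\<close> and \<open>\<rho>\<^sub>l \<lambda>\<close>, the map
  \<open>x \<mapsto> D' (\<omega> \<and> D\<^sup>T x)\<close> sends invariants to invariants. It is injective, since a vector in the
  row space of a real matrix is orthogonal to itself as soon as the matrix annihilates it, and
  \<open>\<omega> \<and> D\<^sup>T x\<close> lies in the row space of \<open>D'\<close>. No comparison of the row space with the space of
  highest weight vectors is needed.\<close>

section \<open>Alternating functions on words\<close>

text \<open>The sign condition of \<open>ext_alg\<close> for letters of any type, so that it also
  applies to single columns and to words of boxes.\<close>

definition alternating :: "('a list \<Rightarrow> complex) \<Rightarrow> bool" where
  "alternating f \<longleftrightarrow>
     (\<forall>w \<pi>. \<pi> permutes {..<length w} \<longrightarrow> f (permute_list \<pi> w) = of_int (sign \<pi>) * f w)"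

text \<open>Adjacent transpositions generate the symmetric group, so this agrees with
  \<open>alternating\<close>; unlike that condition, it can be checked by induction along a
  word.\<close>

definition swap_alternating :: "('a list \<Rightarrow> complex) \<Rightarrow> bool" where
  "swap_alternating f \<longleftrightarrow> (\<forall>u a b v. f (u @ b # a # v) = - f (u @ a # b # v))"

lemma swap_alternatingD: "swap_alternating f \<Longrightarrow> f (u @ b # a # v) = - f (u @ a # b # v)"
  unfolding swap_alternating_def by blast

lemma permute_list_adjacent:
  "permute_list (transpose (length u) (Suc (length u))) (u @ a # b # v) = u @ b # a # v"
proof (rule nth_equalityI)
  fix i assume i: "i < length (permute_list (transpose (length u) (Suc (length u))) (u @ a # b # v))"
  consider "i < length u" | "i = length u" | "i = Suc (length u)" | k where "i = length u + Suc (Suc k)"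
    by (metis add.commute add_Suc_right less_imp_Suc_add linorder_neqE_nat not_less_eq)
  then show "permute_list (transpose (length u) (Suc (length u))) (u @ a # b # v) ! i = (u @ b # a # v) ! i"
    using i by cases (auto simp: permute_list_def nth_append transpose_def Suc_diff_le simp del: upt_Suc)
qed simp

lemma alternating_imp_swap:
  assumes "alternating f" shows "swap_alternating f"
  unfolding swap_alternating_def
proof (intro allI)
  fix u v and a b :: 'a
  let ?t = "transpose (length u) (Suc (length u))" and ?w = "u @ a # b # v"
  have "?t permutes {..<length ?w}" by (rule permutes_swap_id) auto
  then have "f (permute_list ?t ?w) = of_int (sign ?t) * f ?w"
    using assms unfolding alternating_def by blast
  then show "f (u @ b # a # v) = - f ?w"
    by (simp only: permute_list_adjacent) (simp add: sign_swap_id)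
qed

text \<open>Induction on \<open>j\<close>: the transposition of \<open>i\<close> and
  \<open>Suc j\<close> is that of \<open>i\<close> and \<open>j\<close> conjugated by an adjacent
  one, which makes three sign changes.\<close>

lemma swap_alternating_transpose:
  assumes "swap_alternating f" and "i < j" and "j < length w"
  shows "f (permute_list (transpose i j) w) = - f w"
  using assms(2,3)
proof (induction j arbitrary: w)
  case 0
  then show ?case by simp
next
  case (Suc j)
  have adj: "f (permute_list (transpose j (Suc j)) x) = - f x" if "Suc j < length x" for x
  proof -
    have "x = take j x @ x ! j # x ! Suc j # drop (Suc (Suc j)) x"
      using that by (metis Cons_nth_drop_Suc Suc_lessD append_take_drop_id)
    moreover have "length (take j x) = j" using that by simp
    ultimately show ?thesis
      using permute_list_adjacent[of "take j x"] swap_alternatingD[OF assms(1)] by metis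
  qed
  show ?case
  proof (cases "i = j")
    case True
    then show ?thesis using adj Suc.prems by simp
  next
    case False
    then have ij: "i < j" using Suc.prems by simp
    let ?a = "transpose j (Suc j)" and ?t = "transpose i j"
    have perm: "?a permutes {..<length w}" "?t permutes {..<length w}"
      using Suc.prems ij by (auto intro!: permutes_swap_id)
    have "transpose i (Suc j) = ?a \<circ> ?t \<circ> ?a"
      using ij by (auto simp: transpose_def fun_eq_iff)
    moreover have "permute_list (?a \<circ> ?t \<circ> ?a) w =
        permute_list ?a (permute_list ?t (permute_list ?a w))"
      using perm by (simp add: permute_list_compose permutes_compose)
    ultimately have "f (permute_list (transpose i (Suc j)) w)
        = f (permute_list ?a (permute_list ?t (permute_list ?a w)))" by simp
    also have "\<dots> = - f w" using adj Suc ij by simp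
    finally show ?thesis .
  qed
qed

text \<open>Every permutation is a product of transpositions, and each of them changes the
  sign.\<close>

lemma swap_alternating_imp:
  assumes "swap_alternating f" shows "alternating f"
  unfolding alternating_def
proof (intro allI impI)
  fix w :: "'a list" and \<pi> :: "nat \<Rightarrow> nat" assume "\<pi> permutes {..<length w}"
  with finite_lessThan show "f (permute_list \<pi> w) = of_int (sign \<pi>) * f w"
  proof (induction rule: permutes_rev_induct)
    case id
    then show ?case by simp
  next
    case (swap a b p)
    let ?t = "transpose a b"
    have t: "?t permutes {..<length w}" using swap by (auto intro!: permutes_swap_id)
    have neg: "f (permute_list ?t x) = - f x" if "length x = length w" for x
    proof (cases "a < b")
      case True
      then show ?thesis using swap_alternating_transpose[OF assms] swap that by simp
    next
      case False
      then show ?thesis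
        using swap_alternating_transpose[OF assms, of b a x] swap that
        by (simp add: transpose_commute)
    qed
    have "f (permute_list (p \<circ> ?t) w) = - f (permute_list p w)"
      using t neg by (simp add: permute_list_compose)
    moreover have "sign (p \<circ> ?t) = - sign p"
      using swap t by (subst sign_compose) (auto simp: sign_swap_id intro: permutes_imp_permutation[OF finite_lessThan] permutation_swap_id)
    ultimately show ?case using swap by (simp del: o_apply comp_apply)
  qed
qed

lemma alternating_iff_swap: "alternating f \<longleftrightarrow> swap_alternating f"
  using alternating_imp_swap swap_alternating_imp by blast

lemma alternatingD:
  "alternating f \<Longrightarrow> \<pi> permutes {..<length w} \<Longrightarrow> f (permute_list \<pi> w) = of_int (sign \<pi>) * f w"
  unfolding alternating_def by blast

text \<open>The sign of the permutation that sorts the word, or \<open>0\<close> if a letter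
  repeats. Any linear order is allowed; later the letters are boxes in lexicographic order.\<close>

fun list_sign :: "'a::linorder list \<Rightarrow> complex" where
  "list_sign [] = 1"
| "list_sign (x # xs) =
     (\<Prod>y\<leftarrow>xs. if x < y then 1 else if y < x then -1 else 0) * list_sign xs"

lemma alternating_list_sign: "alternating list_sign"
  unfolding alternating_iff_swap swap_alternating_def
proof (intro allI)
  fix u v and a b :: 'a
  show "list_sign (u @ b # a # v) = - list_sign (u @ a # b # v)"
    by (induction u) (auto simp: mult_ac)
qed

lemma cnj_list_sign [simp]: "cnj (list_sign xs) = list_sign xs"
proof (induction xs)
  case (Cons x xs)
  have "cnj (\<Prod>y\<leftarrow>ys. if x < y then 1 else if y < x then -1 else 0)
      = (\<Prod>y\<leftarrow>ys. if x < y then 1 else if y < x then -1 else 0)" for ys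
    by (induction ys) auto
  with Cons show ?case by simp
qed simp

lemma list_sign_square: "distinct xs \<Longrightarrow> list_sign xs * list_sign xs = 1"
proof (induction xs)
  case (Cons x xs)
  define P where "P ys = (\<Prod>y\<leftarrow>ys. if x < y then 1 else if y < x then -1 else (0::complex))" for ys
  have "P ys * P ys = 1" if "x \<notin> set ys" for ys
    using that unfolding P_def by (induction ys) auto
  then have "P xs * P xs = 1" using Cons by simp
  moreover have "list_sign (x # xs) = P xs * list_sign xs" by (simp add: P_def)
  moreover have "list_sign xs * list_sign xs = 1" using Cons by simp
  ultimately show ?case by (simp only: mult_ac) (metis mult.left_commute mult.right_neutral)
qed simp

lemma list_sign_upt [simp]: "list_sign [i..<j] = 1"
proof (induction "j - i" arbitrary: i)
  case (Suc k)
  then have "[i..<j] = i # [Suc i..<j]" by (simp add: upt_conv_Cons)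
  moreover have "(\<Prod>y\<leftarrow>ys. if i < y then 1 else if y < i then -1 else (0::complex)) = 1"
    if "\<forall>y\<in>set ys. i < y" for ys
    using that by (induction ys) auto
  moreover have "list_sign [Suc i..<j] = 1" using Suc by simp
  ultimately show ?case by simp
qed simp


section \<open>The exterior product by recursion on words\<close>

text \<open>A new position in front creates no inversion if it belongs to the set, and otherwise one
  with each element of the set.\<close>

lemma shuffle_sign_Suc:
  assumes "I \<subseteq> {..<n}"
  shows "shuffle_sign (Suc n) (insert 0 (Suc ` I)) = shuffle_sign n I"
    and "shuffle_sign (Suc n) (Suc ` I) = (-1) ^ card I * shuffle_sign n I"
proof -
  let ?A = "{(i, j). i \<in> {..<n} - I \<and> j \<in> I \<and> i < j}"
  have fin: "finite ?A" "finite I"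
    using assms by (auto intro: finite_subset[of _ "{..<n} \<times> {..<n}"] finite_subset)
  have inj: "inj_on (map_prod Suc Suc) ?A" by (auto simp: inj_on_def)
  have mem: "(i, j) \<in> map_prod Suc Suc ` ?A \<longleftrightarrow> (\<exists>i' j'. i = Suc i' \<and> j = Suc j' \<and> (i', j') \<in> ?A)" for i j
    by blast
  have 1: "{(i, j). i \<in> {..<Suc n} - insert 0 (Suc ` I) \<and> j \<in> insert 0 (Suc ` I) \<and> i < j}
      = map_prod Suc Suc ` ?A"
  proof (unfold set_eq_iff split_paired_All, intro allI)
    fix i j
    show "(i, j) \<in> {(i, j). i \<in> {..<Suc n} - insert 0 (Suc ` I) \<and> j \<in> insert 0 (Suc ` I) \<and> i < j}
        \<longleftrightarrow> (i, j) \<in> map_prod Suc Suc ` ?A"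
      unfolding mem by (cases i; cases j) auto
  qed
  show "shuffle_sign (Suc n) (insert 0 (Suc ` I)) = shuffle_sign n I"
    unfolding shuffle_sign_def 1 card_image[OF inj] ..
  have 2: "{(i, j). i \<in> {..<Suc n} - Suc ` I \<and> j \<in> Suc ` I \<and> i < j}
      = map_prod Suc Suc ` ?A \<union> (\<lambda>j. (0, Suc j)) ` I"
  proof (unfold set_eq_iff split_paired_All, intro allI)
    fix i j
    show "(i, j) \<in> {(i, j). i \<in> {..<Suc n} - Suc ` I \<and> j \<in> Suc ` I \<and> i < j}
        \<longleftrightarrow> (i, j) \<in> map_prod Suc Suc ` ?A \<union> (\<lambda>j. (0, Suc j)) ` I"
      unfolding Un_iff mem by (cases i; cases j) auto
  qed
  have "card (map_prod Suc Suc ` ?A \<union> (\<lambda>j. (0, Suc j)) ` I) = card ?A + card I"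
    using fin by (subst card_Un_disjoint) (auto simp: card_image[OF inj] card_image inj_on_def)
  then show "shuffle_sign (Suc n) (Suc ` I) = (-1) ^ card I * shuffle_sign n I"
    unfolding shuffle_sign_def 2 by (simp add: power_add mult.commute)
qed

lemma Pow_lessThan_Suc:
  "Pow {..<Suc n} = (`) Suc ` Pow {..<n} \<union> (\<lambda>I. insert 0 (Suc ` I)) ` Pow {..<n}"
  proof -
  have "Pow (Suc ` {..<n}) = (`) Suc ` Pow {..<n}" by (simp add: image_Pow_surj)
  then show ?thesis unfolding lessThan_Suc_eq_insert_0 Pow_insert by (simp add: image_image)
qed

lemma wedge_Nil [simp]: "wedge f g [] = f [] * g []"
  by (simp add: wedge_def shuffle_sign_def)

text \<open>The sum over position sets splits by whether the first letter goes to \<open>f\<close>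
  or to \<open>g\<close>. In the second case it passes all letters given to \<open>f\<close>, whence
  the degree sign. Later inductions over words rest on this recursion.\<close>

lemma wedge_Cons:
  "wedge f g (a # w) = wedge (\<lambda>u. f (a # u)) g w
     + wedge (\<lambda>u. (-1) ^ length u * f u) (\<lambda>u. g (a # u)) w"
proof -
  let ?n = "length w"
  define t where "t I = shuffle_sign (Suc ?n) I * f (nths (a # w) I)
      * g (nths (a # w) ({..<Suc ?n} - I))" for I
  have inj: "inj_on ((`) Suc) (Pow {..<?n})" "inj_on (\<lambda>I. insert 0 (Suc ` I)) (Pow {..<?n})"
  proof -
    show "inj_on ((`) Suc) (Pow {..<?n})" by (simp add: inj_on_def inj_image_eq_iff)
    show "inj_on (\<lambda>I. insert 0 (Suc ` I)) (Pow {..<?n})"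
      by (rule inj_on_inverseI[where g = "\<lambda>K. {j. Suc j \<in> K}"]) auto
  qed
  have "wedge f g (a # w) = (\<Sum>I\<in>Pow {..<Suc ?n}. t I)"
    by (simp add: wedge_def t_def)
  also have "\<dots> = (\<Sum>I\<in>Pow {..<?n}. t (Suc ` I)) + (\<Sum>I\<in>Pow {..<?n}. t (insert 0 (Suc ` I)))"
  proof -
    have "Suc ` I \<noteq> insert 0 (Suc ` J)" for I J by (metis insertI1 imageE nat.distinct(1))
    then have "(`) Suc ` Pow {..<?n} \<inter> (\<lambda>I. insert 0 (Suc ` I)) ` Pow {..<?n} = {}" by blast
    then show ?thesis
      unfolding Pow_lessThan_Suc
      by (subst sum.union_disjoint) (simp_all add: sum.reindex[OF inj(1)] sum.reindex[OF inj(2)])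
  qed
  also have "(\<Sum>I\<in>Pow {..<?n}. t (insert 0 (Suc ` I))) = wedge (\<lambda>u. f (a # u)) g w"
    unfolding wedge_def
  proof (rule sum.cong)
    fix I assume I: "I \<in> Pow {..<?n}"
    have "{j. Suc j \<in> {..<Suc ?n} - insert 0 (Suc ` I)} = {..<?n} - I" by auto
    moreover have "{j. Suc j \<in> insert 0 (Suc ` I)} = I" by auto
    ultimately show "t (insert 0 (Suc ` I)) = shuffle_sign ?n I * f (a # nths w I) * g (nths w ({..<?n} - I))"
      using I by (simp add: t_def nths_Cons shuffle_sign_Suc)
  qed simp
  also have "(\<Sum>I\<in>Pow {..<?n}. t (Suc ` I)) = wedge (\<lambda>u. (-1) ^ length u * f u) (\<lambda>u. g (a # u)) w"
    unfolding wedge_def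
  proof (rule sum.cong)
    fix I assume I: "I \<in> Pow {..<?n}"
    have 1: "{j. j < ?n \<and> Suc j \<notin> Suc ` I} = {..<?n} - I" by auto
    have 2: "{j. Suc j \<in> Suc ` I} = I" by auto
    have "length (nths w I) = card I"
      using I by (auto simp: length_nths intro!: arg_cong[of _ _ card])
    then show "t (Suc ` I) = shuffle_sign ?n I * ((-1) ^ length (nths w I) * f (nths w I))
        * g (a # nths w ({..<?n} - I))"
      using I by (simp add: t_def nths_Cons shuffle_sign_Suc 1 2)
  qed simp
  finally show ?thesis by simp
qed

lemma wedge_sum_left: "wedge (\<lambda>u. \<Sum>i\<in>A. f i u) g w = (\<Sum>i\<in>A. wedge (f i) g w)"
  unfolding wedge_def
  by (subst sum.swap) (simp add: sum_distrib_left sum_distrib_right mult_ac)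

lemma wedge_sum_right: "wedge f (\<lambda>u. \<Sum>i\<in>A. g i u) w = (\<Sum>i\<in>A. wedge f (g i) w)"
  unfolding wedge_def
  by (subst sum.swap) (simp add: sum_distrib_left sum_distrib_right mult_ac)

lemma wedge_scale_left: "wedge (\<lambda>u. c * f u) g w = c * wedge f g w"
  unfolding wedge_def by (simp add: sum_distrib_left mult_ac)

lemma wedge_scale_right: "wedge f (\<lambda>u. c * g u) w = c * wedge f g w"
  unfolding wedge_def by (simp add: sum_distrib_left mult_ac)

lemma wedge_uminus_left: "wedge (\<lambda>u. - f u) g w = - wedge f g w"
  using wedge_scale_left[of "-1"] by simp

lemma wedge_uminus_right: "wedge f (\<lambda>u. - g u) w = - wedge f g w"
  using wedge_scale_right[of f "-1"] by simp

lemma wedge_zero_left: "wedge (\<lambda>u. 0) g w = 0"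
  by (simp add: wedge_def)

lemma wedge_zero_right: "wedge f (\<lambda>u. 0) w = 0"
  by (simp add: wedge_def)

lemma swap_alternating_Cons:
  "swap_alternating f \<Longrightarrow> swap_alternating (\<lambda>u. f (a # u))"
  unfolding swap_alternating_def by (metis append_Cons)

lemma swap_alternating_signed:
  assumes "swap_alternating f"
  shows "swap_alternating (\<lambda>u. (-1) ^ length u * f u)"
  unfolding swap_alternating_def
proof (intro allI)
  fix u v and a b :: 'a
  show "(-1) ^ length (u @ b # a # v) * f (u @ b # a # v)
      = - ((-1) ^ length (u @ a # b # v) * f (u @ a # b # v))"
    using swap_alternatingD[OF assms, of u b a v] by simp
qed

lemma swap_alternating_wedge:
  assumes "swap_alternating f" and "swap_alternating g"
  shows "swap_alternating (wedge f g)"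
  unfolding swap_alternating_def
proof (intro allI)
  fix u v and a b :: "nat list"
  show "wedge f g (u @ b # a # v) = - wedge f g (u @ a # b # v)"
    using assms
  proof (induction u arbitrary: f g)
    case Nil
    have "f (b # a # u) = - f (a # b # u)" "g (b # a # u) = - g (a # b # u)" for u
      using Nil by (auto dest: swap_alternatingD[of _ "[]"])
    \<comment> \<open>Exchanging \<open>x\<close> and \<open>y\<close> negates the outer two terms,
      as \<open>f\<close> and \<open>g\<close> alternate, and turns each mixed term into the
      negative of the other.\<close>
    moreover have "wedge f g (x # y # v) = wedge (\<lambda>u. f (x # y # u)) g v
        + wedge (\<lambda>u. (-1) ^ length u * f (x # u)) (\<lambda>u. g (y # u)) v
        - wedge (\<lambda>u. (-1) ^ length u * f (y # u)) (\<lambda>u. g (x # u)) v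
        + wedge f (\<lambda>u. g (x # y # u)) v" for x y
      by (simp add: wedge_Cons wedge_uminus_left)
    ultimately show ?case
      by (simp only: wedge_uminus_left wedge_uminus_right append_Nil) simp
  next
    case (Cons c u)
    have "wedge (\<lambda>u. f (c # u)) g (u @ b # a # v) = - wedge (\<lambda>u. f (c # u)) g (u @ a # b # v)"
      using Cons by (intro Cons.IH swap_alternating_Cons)
    moreover have "wedge (\<lambda>u. (-1) ^ length u * f u) (\<lambda>u. g (c # u)) (u @ b # a # v)
        = - wedge (\<lambda>u. (-1) ^ length u * f u) (\<lambda>u. g (c # u)) (u @ a # b # v)"
      using Cons by (intro Cons.IH swap_alternating_Cons swap_alternating_signed)
    ultimately show ?case by (simp add: wedge_Cons)
  qed
qed

lemma alternating_wedge: "alternating f \<Longrightarrow> alternating g \<Longrightarrow> alternating (wedge f g)"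
  unfolding alternating_iff_swap by (rule swap_alternating_wedge)

lemma wedge_outside:
  assumes "\<And>u. \<not> set u \<subseteq> A \<Longrightarrow> f u = 0" and "\<And>u. \<not> set u \<subseteq> A \<Longrightarrow> g u = 0" and "\<not> set w \<subseteq> A"
  shows "wedge f g w = 0"
  using assms
proof (induction w arbitrary: f g)
  case (Cons a w)
  show ?case
  proof (cases "a \<in> A")
    case True
    then have "wedge (\<lambda>u. f (a # u)) g w = 0"
      "wedge (\<lambda>u. (-1) ^ length u * f u) (\<lambda>u. g (a # u)) w = 0"
      using Cons.prems by (intro Cons.IH; simp)+
    then show ?thesis by (simp add: wedge_Cons)
  next
    case False
    then have "f (a # u) = 0" "g (a # u) = 0" for u using Cons.prems by auto
    then show ?thesis by (simp add: wedge_Cons wedge_zero_left wedge_zero_right)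
  qed
qed simp

section \<open>Sums over words\<close>

abbreviation words :: "'a set \<Rightarrow> nat \<Rightarrow> 'a list set" where
  "words A n \<equiv> {xs. set xs \<subseteq> A \<and> length xs = n}"

lemma finite_words: "finite A \<Longrightarrow> finite (words A n)"
  by (rule finite_lists_length_eq)

lemma sum_words_Suc:
  "(\<Sum>xs\<in>words A (Suc n). F xs) = (\<Sum>a\<in>A. \<Sum>xs\<in>words A n. F (a # xs))"
proof -
  have "inj_on (\<lambda>(xs, n). n # xs) (words A n \<times> A)" by (auto simp: inj_on_def)
  then have "(\<Sum>xs\<in>words A (Suc n). F xs) = (\<Sum>(xs, a)\<in>words A n \<times> A. F (a # xs))"
    unfolding lists_length_Suc_eq by (simp add: sum.reindex split_def)
  also have "\<dots> = (\<Sum>xs\<in>words A n. \<Sum>a\<in>A. F (a # xs))"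
    by (rule sum.cartesian_product[symmetric])
  finally show ?thesis by (simp only: sum.swap[of _ A])
qed

lemma sum_words_prod:
  fixes F :: "nat \<Rightarrow> 'a \<Rightarrow> 'b::comm_semiring_1"
  shows "(\<Sum>xs\<in>words A n. \<Prod>k<n. F k (xs ! k)) = (\<Prod>k<n. \<Sum>a\<in>A. F k a)"
proof (induction n arbitrary: F)
  case 0
  have "words A 0 = {[]}" by auto
  then show ?case by simp
next
  case (Suc n)
  show ?case
    unfolding sum_words_Suc
    by (simp add: prod.lessThan_Suc_shift sum_distrib_left[symmetric] Suc.IH[of "\<lambda>k. F (Suc k)"]
        sum_distrib_right del: prod.lessThan_Suc)
qed

section \<open>Words of multi-indices and their columns\<close>

definition column :: "nat \<Rightarrow> 'a list list \<Rightarrow> 'a list" where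
  "column j w = map (\<lambda>b. b ! j) w"

lemma column_simps [simp]: "column j [] = []" "column j (b # w) = b ! j # column j w"
  "length (column j w) = length w"
  by (simp_all add: column_def)

lemma column_nth [simp]: "k < length w \<Longrightarrow> column j w ! k = w ! k ! j"
  by (simp add: column_def)

lemma column_append: "column j (u @ w) = column j u @ column j w"
  by (simp add: column_def)

lemma permute_list_column:
  "\<pi> permutes {..<length w} \<Longrightarrow> permute_list \<pi> (column j w) = column j (permute_list \<pi> w)"
  unfolding column_def by (rule permute_list_map)

lemma multi_index_words: "multi_index d l = words {..<l} d"
  by (auto simp: multi_index_def)

lemma finite_multi_index: "finite (multi_index d l)"
  unfolding multi_index_words by (rule finite_words) simp

lemma column_in_words:
  assumes "w \<in> words (multi_index d l) n" and "j < d"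
  shows "column j w \<in> words {..<l} n"
proof -
  have "b ! j < l" if "b \<in> set w" for b
    using assms that unfolding multi_index_def by (auto dest!: nth_mem subsetD)
  then show ?thesis using assms by (auto simp: column_def)
qed

lemma bij_betw_columns:
  "bij_betw (\<lambda>w. map (\<lambda>j. column j w) [0..<d]) (words (words A d) n) (words (words A n) d)"
proof -
  \<comment> \<open>Both facts are stated for all \<open>d\<close> and \<open>n\<close>, since
    transposing back is the same operation with the two exchanged.\<close>
  have into: "map (\<lambda>j. column j w) [0..<d] \<in> words (words A n) d"
    if "w \<in> words (words A d) n" for w :: "'a list list" and d n
    using that by (auto simp: column_def subset_iff dest!: nth_mem)
  have inverse: "map (\<lambda>k. column k (map (\<lambda>j. column j w) [0..<d])) [0..<n] = w"
    if "w \<in> words (words A d) n" for w :: "'a list list" and d n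
    using that by (intro nth_equalityI) (auto simp: column_def subset_iff intro!: nth_equalityI)
  show ?thesis
    by (rule bij_betw_byWitness[where f' = "\<lambda>cs. map (\<lambda>k. column k cs) [0..<n]"])
      (use into inverse in blast)+
qed

lemma sum_columns:
  "(\<Sum>w\<in>words (multi_index d l) n. F (map (\<lambda>j. column j w) [0..<d]))
     = (\<Sum>cs\<in>words (words {..<l} n) d. F cs)"
  unfolding multi_index_words by (rule sum.reindex_bij_betw[OF bij_betw_columns])

text \<open>The columns of a word range independently of each other. This reduces sums over words to
  one tensor factor at a time.\<close>

lemma sum_prod_columns:
  fixes F :: "nat \<Rightarrow> nat list \<Rightarrow> 'b::comm_semiring_1"
  shows "(\<Sum>w\<in>words (multi_index d l) n. \<Prod>j<d. F j (column j w))
     = (\<Prod>j<d. \<Sum>c\<in>words {..<l} n. F j c)"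
  using sum_columns[of "\<lambda>cs. \<Prod>j<d. F j (cs ! j)" d l n]
  by (simp add: sum_words_prod[where F = F and n = d])


section \<open>The Cayley form\<close>

text \<open>Exchanging two equal letters fixes the word but changes the sign.\<close>

lemma alternating_repeat:
  assumes "alternating f" and "\<not> distinct w"
  shows "f w = 0"
proof -
  obtain i j where ij: "i < j" "j < length w" "w ! i = w ! j"
    using assms(2) unfolding distinct_conv_nth by (metis linorder_neqE_nat)
  then have "permute_list (transpose i j) w = w"
    by (intro nth_equalityI) (auto simp: permute_list_def transpose_def simp del: upt_Suc)
  then have "f w = - f w"
    using swap_alternating_transpose[OF alternating_imp_swap[OF assms(1)] ij(1,2)] by simp
  then show ?thesis by simp
qed

text \<open>A word of length \<open>l\<close> with letter set \<open>{..<l}\<close> has no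
  repetition, so the nonzero values are the signs of permutations. The length condition makes the
  form homogeneous of degree \<open>l\<close>.\<close>

definition levi_civita :: "nat \<Rightarrow> nat list \<Rightarrow> complex" where
  "levi_civita l c = (if length c = l \<and> set c = {..<l} then list_sign c else 0)"

lemma alternating_levi_civita: "alternating (levi_civita l)"
  unfolding alternating_def levi_civita_def
  using alternatingD[OF alternating_list_sign] by auto

lemma permute_list_upt: "permute_list \<pi> [0..<l] = map \<pi> [0..<l]" if "\<pi> permutes {..<l}"
  using that by (intro nth_equalityI) (auto simp: permute_list_def permutes_in_image[of \<pi> "{..<l}", simplified])

lemma levi_civita_permutation: "\<pi> permutes {..<l} \<Longrightarrow> levi_civita l (map \<pi> [0..<l]) = of_int (sign \<pi>)"
  using alternatingD[OF alternating_list_sign, of \<pi> "[0..<l]"]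
  by (simp add: levi_civita_def permute_list_upt permutes_image atLeast0LessThan)

lemma full_word_permutation:
  assumes "length c = l" and "set c = {..<l}"
  obtains \<pi> where "\<pi> permutes {..<l}" and "c = map \<pi> [0..<l]"
proof -
  have "distinct c" using assms by (simp add: card_distinct)
  then have "mset c = mset [0..<l]"
    using assms by (subst set_eq_iff_mset_eq_distinct[symmetric]) (auto simp: atLeast0LessThan)
  then obtain \<pi> where "\<pi> permutes {..<length [0..<l]}" "permute_list \<pi> [0..<l] = c"
    using mset_eq_permutation by blast
  then show ?thesis using that by (simp add: permute_list_upt)
qed

text \<open>Alternating forms of top degree form a line: a word of \<open>l\<close> letters below
  \<open>l\<close> either rearranges \<open>[0..<l]\<close> or repeats a letter.\<close>

lemma alternating_eq_levi_civita:
  assumes "alternating f" and "length c = l" and "set c \<subseteq> {..<l}"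
  shows "f c = levi_civita l c * f [0..<l]"
proof (cases "set c = {..<l}")
  case True
  then obtain \<pi> where \<pi>: "\<pi> permutes {..<l}" "c = map \<pi> [0..<l]"
    using full_word_permutation assms(2) by blast
  then show ?thesis
    using alternatingD[OF assms(1), of \<pi> "[0..<l]"] levi_civita_permutation[OF \<pi>(1)]
    by (simp add: permute_list_upt)
next
  case False
  then have "\<not> distinct c"
    using assms distinct_card[of c] card_subset_eq[of "{..<l}" "set c"] by auto
  then show ?thesis
    using False alternating_repeat[OF assms(1)] by (simp add: levi_civita_def)
qed

text \<open>At most one permutation spells out \<open>c\<close>, so at most one term survives. The
  left side is what a single tensor factor contributes to \<open>cayley\<close>.\<close>

lemma sum_permutations_eq_levi_civita:
  assumes "length c = l"
  shows "(\<Sum>\<pi>\<in>{\<pi>. \<pi> permutes {..<l}}. of_int (sign \<pi>) * (\<Prod>i<l. if c ! i = \<pi> i then 1 else 0))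
     = levi_civita l c"
proof (cases "set c = {..<l}")
  case True
  then obtain \<rho> where \<rho>: "\<rho> permutes {..<l}" "c = map \<rho> [0..<l]"
    using full_word_permutation assms by blast
  have "(\<Prod>i<l. if c ! i = \<pi> i then 1 else (0::complex)) = (if \<pi> = \<rho> then 1 else 0)"
    if "\<pi> permutes {..<l}" for \<pi>
  proof -
    have "(\<forall>i<l. c ! i = \<pi> i) \<longleftrightarrow> \<pi> = \<rho>"
    proof
      assume *: "\<forall>i<l. c ! i = \<pi> i"
      show "\<pi> = \<rho>"
      proof
        fix i show "\<pi> i = \<rho> i"
          using * \<rho> that permutes_not_in[of \<pi> "{..<l}" i] permutes_not_in[of \<rho> "{..<l}" i]
          by (cases "i < l") auto
      qed
    qed (use \<rho> in auto)
    then show ?thesis by (auto simp: prod_zero_iff)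
  qed
  then have "(\<Sum>\<pi>\<in>{\<pi>. \<pi> permutes {..<l}}. of_int (sign \<pi>) * (\<Prod>i<l. if c ! i = \<pi> i then 1 else 0))
     = (\<Sum>\<pi>\<in>{\<pi>. \<pi> permutes {..<l}}. if \<pi> = \<rho> then of_int (sign \<pi>) else (0::complex))"
    by (intro sum.cong) auto
  also have "\<dots> = of_int (sign \<rho>)"
    using \<rho> by (simp add: sum.delta finite_permutations)
  finally show ?thesis using levi_civita_permutation[OF \<rho>(1)] \<rho>(2) by simp
next
  case False
  have "(\<Prod>i<l. if c ! i = \<pi> i then 1 else (0::complex)) = 0" if "\<pi> permutes {..<l}" for \<pi>
  proof (rule ccontr)
    assume "\<not> ?thesis"
    then have "\<forall>i<l. c ! i = \<pi> i" by (auto simp: prod_zero_iff split: if_splits)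
    then have "c = map \<pi> [0..<l]" using assms by (intro nth_equalityI) auto
    then have "set c = {..<l}" using permutes_image[OF that] by (simp add: atLeast0LessThan)
    then show False using False by simp
  qed
  then have "(\<Sum>\<pi>\<in>{\<pi>. \<pi> permutes {..<l}}. of_int (sign \<pi>) * (\<Prod>i<l. if c ! i = \<pi> i then 1 else 0))
     = (0::complex)"
    by (intro sum.neutral ballI) (simp del: prod_zero_iff)
  then show ?thesis using False by (simp add: levi_civita_def)
qed

section \<open>Exterior products of vectors as determinants\<close>

lemma wedge_delta_Nil: "wedge (delta []) g w = g w"
proof (induction w arbitrary: g)
  case (Cons a w)
  have 1: "(\<lambda>u. (-1) ^ length u * delta [] u) = delta []" by (auto simp: delta_def)
  have 2: "(\<lambda>u. delta [] (a # u)) = (\<lambda>u. 0)" by (simp add: delta_def)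
  show ?case unfolding wedge_Cons 1 2 wedge_zero_left Cons by simp
qed (simp add: delta_def)

text \<open>Exactly one letter goes to \<open>ext_vec x\<close>, so the product is an alternating
  sum over its position.\<close>

lemma wedge_ext_vec:
  "wedge (ext_vec x) g w = (\<Sum>k<length w. (-1) ^ k * x (w ! k) * g (take k w @ drop (Suc k) w))"
proof (induction w arbitrary: g)
  case Nil
  then show ?case by (simp add: ext_vec_def)
next
  case (Cons a w)
  have "(\<lambda>u. ext_vec x (a # u)) = (\<lambda>u. x a * delta [] u)"
    by (auto simp: ext_vec_def delta_def split: list.splits)
  then have "wedge (\<lambda>u. ext_vec x (a # u)) g w = x a * g w"
    by (simp add: wedge_scale_left wedge_delta_Nil)
  moreover have "(\<lambda>u. (-1) ^ length u * ext_vec x u) = (\<lambda>u. - ext_vec x u)"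
    by (auto simp: ext_vec_def split: list.splits)
  ultimately show ?case
    by (simp add: wedge_Cons wedge_uminus_left Cons sum.lessThan_Suc_shift sum_negf del: sum.lessThan_Suc)
qed

text \<open>Splitting off the first vector by \<open>wedge_ext_vec\<close> is the Laplace expansion
  along the first row.\<close>

lemma wedge_vecs_det:
  "wedge_vecs xs w = (if length w = length xs
     then det (mat (length xs) (length xs) (\<lambda>(i, k). (xs ! i) (w ! k))) else 0)"
proof (induction xs arbitrary: w)
  case Nil
  then show ?case by (simp add: wedge_vecs_def delta_def)
next
  case (Cons x xs)
  let ?n = "length xs"
  have rec: "wedge_vecs (x # xs) w
      = (\<Sum>k<length w. (-1) ^ k * x (w ! k) * wedge_vecs xs (take k w @ drop (Suc k) w))"
    by (simp add: wedge_vecs_def wedge_ext_vec)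
  show ?case
  proof (cases "length w = Suc ?n")
    case False
    then have "length (take k w @ drop (Suc k) w) \<noteq> ?n" if "k < length w" for k
      using that by simp
    then show ?thesis using False unfolding rec Cons by simp
  next
    case True
    let ?A = "mat (Suc ?n) (Suc ?n) (\<lambda>(i, k). ((x # xs) ! i) (w ! k))"
    have "mat_delete ?A 0 k = mat ?n ?n (\<lambda>(i, j). (xs ! i) ((take k w @ drop (Suc k) w) ! j))"
      if "k < Suc ?n" for k
      using that True by (intro eq_matI) (auto simp: mat_delete_def nth_append)
    then have "det ?A = (\<Sum>k<Suc ?n. (-1) ^ k * x (w ! k) * wedge_vecs xs (take k w @ drop (Suc k) w))"
      using True by (subst laplace_expansion_row[of _ "Suc ?n" 0])
        (auto simp: cofactor_def Cons mult_ac intro!: sum.cong)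
    then show ?thesis using True by (simp add: rec)
  qed
qed

lemma wedge_vecs_permutations:
  assumes "length w = length xs"
  shows "wedge_vecs xs w = (\<Sum>\<sigma>\<in>{\<sigma>. \<sigma> permutes {..<length w}}.
     of_int (sign \<sigma>) * (\<Prod>i<length w. (xs ! i) (w ! \<sigma> i)))"
  using assms unfolding wedge_vecs_det
  by (auto simp: det_def atLeast0LessThan permutes_in_image[of _ "{..<length w}", simplified]
      intro!: sum.cong prod.cong)

lemma sum_fun_apply: "(\<Sum>x\<in>A. f x) w = (\<Sum>x\<in>A. f x w)"
  by (induction A rule: infinite_finite_induct) auto

lemma sign_foldr_comp:
  assumes "\<forall>\<pi>\<in>set \<pi>s. \<pi> permutes A" and "finite A"
  shows "sign (foldr (\<circ>) \<pi>s id) = (\<Prod>j<length \<pi>s. sign (\<pi>s ! j))"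
proof -
  have "foldr (\<circ>) \<pi>s id permutes A \<and> sign (foldr (\<circ>) \<pi>s id) = (\<Prod>j<length \<pi>s. sign (\<pi>s ! j))"
    using assms(1)
  proof (induction \<pi>s)
    case (Cons \<pi> \<pi>s)
    from Cons.prems have \<pi>: "\<pi> permutes A" and rest: "\<forall>\<pi>\<in>set \<pi>s. \<pi> permutes A"
      by simp_all
    note IH = Cons.IH[OF rest, THEN conjunct1] Cons.IH[OF rest, THEN conjunct2]
    have "sign (\<pi> \<circ> foldr (\<circ>) \<pi>s id) = sign \<pi> * (\<Prod>j<length \<pi>s. sign (\<pi>s ! j))"
      unfolding IH(2)[symmetric]
      by (rule sign_compose[OF permutes_imp_permutation[OF assms(2) \<pi>]
            permutes_imp_permutation[OF assms(2) IH(1)]])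
    moreover have "\<pi> \<circ> foldr (\<circ>) \<pi>s id permutes A" by (rule permutes_compose[OF IH(1) \<pi>])
    moreover have "foldr (\<circ>) (\<pi> # \<pi>s) id = \<pi> \<circ> foldr (\<circ>) \<pi>s id" by simp
    ultimately show ?case
      by (simp only: prod.lessThan_Suc_shift list.size nth_Cons_0 nth_Cons_Suc add_0_right add_Suc_right)
  qed (simp add: permutes_id)
  then show ?thesis ..
qed

text \<open>After each exterior product is expanded over \<open>\<sigma>\<close>, the sums over the
  \<open>d\<close> permutations separate. Reordering by \<open>\<sigma>\<close> costs one sign per
  column, and the exterior product adds one more. As \<open>d + 1\<close> is even, all choices of
  \<open>\<sigma>\<close> contribute equally, which gives the factor \<open>fact l\<close>.\<close>

lemma cayley_eq:
  assumes "odd d"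
  shows "cayley d l w = (if set w \<subseteq> multi_index d l
     then fact l * (\<Prod>j<d. levi_civita l (column j w)) else 0)"
proof -
  define P where "P = {\<pi>. \<pi> permutes {..<l}}"
  have d: "d > 0" using assms by (cases d) auto
  define V where "V \<pi>s = map (\<lambda>i. pure_tensor (map (\<lambda>\<pi>. delta (\<pi> i :: nat)) \<pi>s)) [0..<l]" for \<pi>s
  have dom: "{\<pi>s. length \<pi>s = d \<and> (\<forall>\<pi>\<in>set \<pi>s. \<pi> permutes {..<l})} = words P d"
    by (auto simp: P_def)
  have cayley: "cayley d l w = (\<Sum>\<pi>s\<in>words P d. (\<Prod>j<d. of_int (sign (\<pi>s ! j))) * wedge_vecs (V \<pi>s) w)"
    unfolding cayley_def dom sum_fun_apply
  proof (rule sum.cong[OF refl])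
    fix \<pi>s assume "\<pi>s \<in> words P d"
    then have "sign (foldr (\<circ>) \<pi>s id) = (\<Prod>j<d. sign (\<pi>s ! j))"
      using sign_foldr_comp[of \<pi>s "{..<l}"] by (auto simp: P_def)
    then show "fscale (of_int (sign (foldr (\<circ>) \<pi>s id)))
          (wedge_vecs (map (\<lambda>i. pure_tensor (map (\<lambda>\<pi>. delta (\<pi> i)) \<pi>s)) [0..<l])) w
        = (\<Prod>j<d. of_int (sign (\<pi>s ! j))) * wedge_vecs (V \<pi>s) w"
      by (simp only: fscale_def V_def of_int_prod)
  qed
  \<comment> \<open>In the first two cases both sides vanish: the degree is wrong, or every product
    contains the value of a pure tensor at a letter of the wrong length.\<close>
  consider "length w \<noteq> l" | k where "length w = l" "k < l" "length (w ! k) \<noteq> d"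
    | "length w = l" "\<forall>k<l. length (w ! k) = d"
    by metis
  then show ?thesis
  proof cases
    case 1
    then have "wedge_vecs (V \<pi>s) w = 0" for \<pi>s by (simp add: wedge_vecs_det V_def)
    then show ?thesis using 1 d by (auto simp: cayley levi_civita_def)
  next
    case (2 k)
    have "wedge_vecs (V \<pi>s) w = 0" if \<pi>s: "\<pi>s \<in> words P d" for \<pi>s
    proof -
      have "(\<Prod>i<l. (V \<pi>s ! i) (w ! \<sigma> i)) = 0" if "\<sigma> permutes {..<l}" for \<sigma>
      proof -
        have "k \<in> \<sigma> ` {..<l}" using permutes_image[OF that] 2 by simp
        then obtain i where "i < l" "\<sigma> i = k" by auto
        then have "(V \<pi>s ! i) (w ! \<sigma> i) = 0" using 2 \<pi>s by (simp add: V_def pure_tensor_def)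
        then show ?thesis using \<open>i < l\<close> by (intro prod_zero) auto
      qed
      then have "(\<Sum>\<sigma>\<in>P. of_int (sign \<sigma>) * (\<Prod>i<l. (V \<pi>s ! i) (w ! \<sigma> i))) = 0"
        by (intro sum.neutral) (simp add: P_def del: prod_zero_iff)
      moreover have "length w = length (V \<pi>s)" using 2 by (simp add: V_def)
      ultimately show ?thesis using 2 by (simp only: wedge_vecs_permutations P_def)
    qed
    moreover have "\<not> set w \<subseteq> multi_index d l"
      using 2 nth_mem[of k w] unfolding multi_index_def by blast
    ultimately show ?thesis by (simp add: cayley)
  next
    case 3
    have levi: "(\<Sum>\<pi>\<in>P. of_int (sign \<pi>) * (\<Prod>i<l. if column j w ! \<sigma> i = \<pi> i then 1 else 0))
        = of_int (sign \<sigma>) * levi_civita l (column j w)" if "\<sigma> \<in> P" for \<sigma> j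
    proof -
      have \<sigma>: "\<sigma> permutes {..<length (column j w)}" using that 3 by (simp add: P_def)
      show ?thesis
        using alternatingD[OF alternating_levi_civita \<sigma>, of l] \<sigma> 3
          sum_permutations_eq_levi_civita[of "permute_list \<sigma> (column j w)" l]
        by (simp add: P_def permute_list_nth del: column_nth)
    qed
    have entry: "(\<Prod>i<l. (V \<pi>s ! i) (w ! \<sigma> i)) = (\<Prod>j<d. \<Prod>i<l. if column j w ! \<sigma> i = (\<pi>s ! j) i then 1 else 0)"
      if "\<pi>s \<in> words P d" "\<sigma> \<in> P" for \<pi>s \<sigma>
    proof -
      have "(V \<pi>s ! i) (w ! \<sigma> i) = (\<Prod>j<d. if column j w ! \<sigma> i = (\<pi>s ! j) i then 1 else 0)"
        if "i < l" for i
      proof -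
        have "\<sigma> i < l"
          using permutes_in_image[of \<sigma> "{..<l}" i] that \<open>\<sigma> \<in> P\<close> by (simp add: P_def)
        moreover have "length \<pi>s = d" using \<open>\<pi>s \<in> words P d\<close> by simp
        ultimately have "(V \<pi>s ! i) (w ! \<sigma> i) = (\<Prod>j<d. delta ((\<pi>s ! j) i) (w ! \<sigma> i ! j))"
          using 3 that by (simp add: V_def pure_tensor_def)
        then show ?thesis using \<open>\<sigma> i < l\<close> 3 by (simp add: delta_def)
      qed
      then have "(\<Prod>i<l. (V \<pi>s ! i) (w ! \<sigma> i)) = (\<Prod>i<l. \<Prod>j<d. if column j w ! \<sigma> i = (\<pi>s ! j) i then 1 else 0)"
        by (intro prod.cong) auto
      then show ?thesis by (simp only: prod.swap[of _ "{..<d}"])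
    qed
    have "cayley d l w = (\<Sum>\<pi>s\<in>words P d. (\<Prod>j<d. of_int (sign (\<pi>s ! j))) *
        (\<Sum>\<sigma>\<in>P. of_int (sign \<sigma>) * (\<Prod>j<d. \<Prod>i<l. if column j w ! \<sigma> i = (\<pi>s ! j) i then 1 else 0)))"
      unfolding cayley using 3 entry
      by (intro sum.cong refl arg_cong2[where f = "(*)"], subst wedge_vecs_permutations)
        (auto simp: V_def P_def intro!: sum.cong)
    also have "\<dots> = (\<Sum>\<sigma>\<in>P. of_int (sign \<sigma>) * (\<Sum>\<pi>s\<in>words P d. \<Prod>j<d. of_int (sign (\<pi>s ! j)) *
        (\<Prod>i<l. if column j w ! \<sigma> i = (\<pi>s ! j) i then 1 else 0)))"
      unfolding sum_distrib_left prod.distrib by (subst sum.swap) (simp add: mult_ac)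
    also have "\<dots> = (\<Sum>\<sigma>\<in>P. of_int (sign \<sigma>) * (\<Prod>j<d. of_int (sign \<sigma>) * levi_civita l (column j w)))"
      by (rule sum.cong[OF refl], subst sum_words_prod) (simp add: levi)
    also have "\<dots> = (\<Sum>\<sigma>\<in>P. of_int (sign \<sigma> ^ Suc d) * (\<Prod>j<d. levi_civita l (column j w)))"
      by (simp add: prod.distrib mult.assoc)
    also have "\<dots> = (\<Sum>\<sigma>\<in>P. \<Prod>j<d. levi_civita l (column j w))"
    proof (rule sum.cong)
      fix \<sigma>
      have "sign \<sigma> ^ Suc d = 1" using assms by (cases \<sigma> rule: sign_cases) simp_all
      then show "of_int (sign \<sigma> ^ Suc d) * (\<Prod>j<d. levi_civita l (column j w))
          = (\<Prod>j<d. levi_civita l (column j w))" by simp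
    qed simp
    also have "\<dots> = fact l * (\<Prod>j<d. levi_civita l (column j w))"
      by (simp add: P_def card_permutations[of "{..<l}" l])
    finally have *: "cayley d l w = fact l * (\<Prod>j<d. levi_civita l (column j w))" .
    show ?thesis
    proof (cases "set w \<subseteq> multi_index d l")
      \<comment> \<open>A coordinate outside \<open>{..<l}\<close> spoils the letter set of its
        column, so the product vanishes too.\<close>
      case False
      then obtain b where b: "b \<in> set w" "b \<notin> multi_index d l" by blast
      then have len: "length b = d" using 3 by (metis in_set_conv_nth)
      then obtain x where "x \<in> set b" "\<not> x < l" using b by (auto simp: multi_index_def)
      then obtain j where "j < d" "\<not> b ! j < l" using len by (metis in_set_conv_nth)
      with b have "levi_civita l (column j w) = 0" by (auto simp: levi_civita_def column_def)
      then show ?thesis using * False \<open>j < d\<close> by auto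
    qed (simp add: *)
  qed
qed

section \<open>The group action\<close>

lemma ext_act_words:
  "ext_act d l As f w = (if set w \<subseteq> multi_index d l
     then \<Sum>u\<in>words (multi_index d l) (length w).
       (\<Prod>k<length w. tensor_entry As (w ! k) (u ! k)) * f u
     else 0)"
  unfolding ext_act_def by (auto intro!: sum.cong)

lemma ext_act_Nil [simp]: "ext_act d l As f [] = f []"
proof -
  have "words (multi_index d l) 0 = {[]}" by auto
  then show ?thesis by (simp add: ext_act_words)
qed

lemma ext_act_Cons:
  assumes "a \<in> multi_index d l"
  shows "ext_act d l As f (a # w)
     = (\<Sum>b\<in>multi_index d l. tensor_entry As a b * ext_act d l As (\<lambda>u. f (b # u)) w)"
  using assms
  by (simp add: ext_act_words sum_words_Suc prod.lessThan_Suc_shift sum_distrib_left mult.assoc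
      del: prod.lessThan_Suc)

lemma ext_act_outside: "\<not> set w \<subseteq> multi_index d l \<Longrightarrow> ext_act d l As f w = 0"
  by (simp add: ext_act_def)

lemma ext_act_add: "ext_act d l As (\<lambda>u. f u + g u) w = ext_act d l As f w + ext_act d l As g w"
  by (simp add: ext_act_words sum.distrib distrib_left)

lemma ext_act_signed:
  "ext_act d l As (\<lambda>u. (-1) ^ length u * f u) w = (-1) ^ length w * ext_act d l As f w"
  by (auto simp: ext_act_words sum_distrib_left mult_ac intro!: sum.cong)

text \<open>The group acts by algebra homomorphisms. In the induction, both sides send the first
  letter through the matrix of the tuple before handing it to a factor, and the degree sign commutes
  with the action.\<close>

lemma ext_act_wedge:
  "ext_act d l As (wedge f g) w = wedge (ext_act d l As f) (ext_act d l As g) w"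
proof (cases "set w \<subseteq> multi_index d l")
  case True
  let ?E = "ext_act d l As" and ?M = "tensor_entry As"
  from True show ?thesis
  proof (induction w arbitrary: f g)
    case (Cons a w)
    have a: "a \<in> multi_index d l" and w: "set w \<subseteq> multi_index d l" using Cons.prems by auto
    have "wedge (\<lambda>u. ?E f (a # u)) (?E g) w
        = (\<Sum>b\<in>multi_index d l. ?M a b * ?E (wedge (\<lambda>u. f (b # u)) g) w)"
      by (simp add: ext_act_Cons[OF a] wedge_sum_left wedge_scale_left Cons.IH[OF w])
    moreover have "wedge (\<lambda>u. (-1) ^ length u * ?E f u) (\<lambda>u. ?E g (a # u)) w
        = (\<Sum>b\<in>multi_index d l. ?M a b * ?E (wedge (\<lambda>u. (-1) ^ length u * f u) (\<lambda>u. g (b # u))) w)"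
      by (simp add: ext_act_Cons[OF a] wedge_sum_right wedge_scale_right Cons.IH[OF w]
          ext_act_signed[symmetric])
    ultimately show ?case
      unfolding wedge_Cons ext_act_Cons[OF a] ext_act_add
      by (simp add: distrib_left sum.distrib)
  qed simp
next
  case False
  have "wedge (ext_act d l As f) (ext_act d l As g) w = 0"
    using False by (intro wedge_outside[of "multi_index d l"] ext_act_outside)
  then show ?thesis using False by (simp add: ext_act_outside)
qed

section \<open>Reindexing sums over words, and minors in one tensor factor\<close>

lemma bij_betw_permute_list:
  assumes "\<pi> permutes {..<n}"
  shows "bij_betw (permute_list \<pi>) (words A n) (words A n)"
proof -
  have inv: "inv_into UNIV \<pi> permutes {..<n}" using assms by (rule permutes_inv)
  have cancel: "permute_list \<rho> (permute_list \<sigma> w) = w"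
    if "\<sigma> \<circ> \<rho> = id" "\<rho> permutes {..<n}" "w \<in> words A n" for \<rho> \<sigma> and w :: "'a list"
    using that permute_list_compose[of \<rho> w \<sigma>] by simp
  show ?thesis
  proof (rule bij_betw_byWitness[where f' = "permute_list (inv_into UNIV \<pi>)"])
    show "\<forall>w\<in>words A n. permute_list (inv_into UNIV \<pi>) (permute_list \<pi> w) = w"
      using cancel[OF permutes_inv_o(1)[OF assms] inv] by blast
    show "\<forall>w\<in>words A n. permute_list \<pi> (permute_list (inv_into UNIV \<pi>) w) = w"
      using cancel[OF permutes_inv_o(2)[OF assms] assms] by blast
    show "permute_list \<pi> ` words A n \<subseteq> words A n" using assms by auto
    show "permute_list (inv_into UNIV \<pi>) ` words A n \<subseteq> words A n" using inv by auto
  qed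
qed

lemma sum_words_permute:
  assumes "\<pi> permutes {..<n}"
  shows "(\<Sum>w\<in>words A n. F (permute_list \<pi> w)) = (\<Sum>w\<in>words A n. F w)"
  using sum.reindex_bij_betw[OF bij_betw_permute_list[OF assms]] .

text \<open>For \<open>length x = l\<close>, the determinant of the matrix whose rows are the rows
  of \<open>A\<close> listed by \<open>x\<close>.\<close>

definition minor_sum :: "nat \<Rightarrow> complex mat \<Rightarrow> nat list \<Rightarrow> complex" where
  "minor_sum l A x =
     (\<Sum>c\<in>words {..<l} (length x). (\<Prod>k<length x. A $$ (x ! k, c ! k)) * levi_civita l c)"

text \<open>The summation word is permuted along with \<open>x\<close>, so the products of entries
  stay and only the Levi-Civita factor changes sign.\<close>

lemma alternating_minor_sum: "alternating (minor_sum l A)"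
  unfolding alternating_def
proof (intro allI impI)
  fix x \<pi> assume \<pi>: "\<pi> permutes {..<length (x :: nat list)}"
  let ?n = "length x"
  have "minor_sum l A (permute_list \<pi> x) =
      (\<Sum>c\<in>words {..<l} ?n. (\<Prod>k<?n. A $$ (permute_list \<pi> x ! k, permute_list \<pi> c ! k)) *
         levi_civita l (permute_list \<pi> c))"
    unfolding minor_sum_def length_permute_list
    by (rule sum_words_permute[OF \<pi>, symmetric])
  also have "\<dots> = (\<Sum>c\<in>words {..<l} ?n. of_int (sign \<pi>) *
      ((\<Prod>k<?n. A $$ (x ! k, c ! k)) * levi_civita l c))"
  proof (rule sum.cong[OF refl])
    fix c assume c: "c \<in> words {..<l} ?n"
    have "(\<Prod>k<?n. A $$ (permute_list \<pi> x ! k, permute_list \<pi> c ! k)) = (\<Prod>k<?n. A $$ (x ! \<pi> k, c ! \<pi> k))"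
      using \<pi> c by (intro prod.cong) (simp_all add: permute_list_nth)
    also have "\<dots> = (\<Prod>k<?n. A $$ (x ! k, c ! k))"
      using prod.permute[OF \<pi>, of "\<lambda>k. A $$ (x ! k, c ! k)"] by (simp add: comp_def)
    finally show "(\<Prod>k<?n. A $$ (permute_list \<pi> x ! k, permute_list \<pi> c ! k)) * levi_civita l (permute_list \<pi> c)
        = of_int (sign \<pi>) * ((\<Prod>k<?n. A $$ (x ! k, c ! k)) * levi_civita l c)"
      using alternatingD[OF alternating_levi_civita, of \<pi> c l] \<pi> c by (simp add: mult_ac)
  qed
  finally show "minor_sum l A (permute_list \<pi> x) = of_int (sign \<pi>) * minor_sum l A x"
    by (simp add: minor_sum_def sum_distrib_left)
qed

text \<open>Because of alternation, \<open>x = [0..<l]\<close> suffices. There a nonzero product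
  forces \<open>k \<le> \<pi> k\<close> for all \<open>k\<close>, so only the identity
  contributes.\<close>

lemma minor_sum_upper_triangular:
  assumes "A \<in> carrier_mat l l" and "upper_triangular A"
    and "length x = l" and "set x \<subseteq> {..<l}"
  shows "minor_sum l A x = (\<Prod>i<l. A $$ (i, i)) * levi_civita l x"
proof -
  have zero: "(\<Prod>k<l. A $$ ([0..<l] ! k, c ! k)) * levi_civita l c = 0"
    if c: "c \<in> words {..<l} l" "c \<noteq> [0..<l]" for c
  proof (rule ccontr)
    assume *: "\<not> ?thesis"
    then have "set c = {..<l}" by (auto simp: levi_civita_def split: if_splits)
    then obtain \<pi> where \<pi>: "\<pi> permutes {..<l}" "c = map \<pi> [0..<l]"
      using full_word_permutation c by blast
    have "A $$ (k, \<pi> k) \<noteq> 0" if "k < l" for k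
    proof
      assume "A $$ (k, \<pi> k) = 0"
      then have "(\<Prod>k<l. A $$ ([0..<l] ! k, c ! k)) = 0"
        using that \<pi> by (intro prod_zero bexI[of _ k]) auto
      then show False using * by simp
    qed
    then have "\<forall>k\<in>{..<l}. k \<le> \<pi> k"
      using upper_triangularD[OF assms(2)] assms(1) by (metis carrier_matD(1) lessThan_iff not_le)
    then have "\<pi> = id" using \<pi>(1) by (intro permutes_natset_ge)
    then show False using \<pi>(2) c(2) by simp
  qed
  have "minor_sum l A [0..<l] = (\<Sum>c\<in>words {..<l} l. if c = [0..<l] then \<Prod>i<l. A $$ (i, i) else 0)"
    unfolding minor_sum_def using zero
    by (intro sum.cong) (auto simp: levi_civita_def atLeast0LessThan)
  also have "\<dots> = (\<Prod>i<l. A $$ (i, i))" by (simp add: finite_words sum.delta atLeast0LessThan)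
  finally show ?thesis
    using alternating_eq_levi_civita[OF alternating_minor_sum assms(3,4)] by simp
qed

text \<open>In each column the top form is multiplied by a determinant. Upper triangular matrices
  cover both the diagonal tuples, where the scalar shifts the weight, and the unitriangular ones,
  where it is \<open>1\<close>.\<close>

lemma ext_act_cayley:
  assumes "odd d" and "length As = d"
    and "\<And>A. A \<in> set As \<Longrightarrow> A \<in> carrier_mat l l \<and> upper_triangular A"
  shows "ext_act d l As (cayley d l) = (\<lambda>w. (\<Prod>j<d. \<Prod>i<l. (As ! j) $$ (i, i)) * cayley d l w)"
proof
  fix w
  have d: "d > 0" using assms by (cases d) auto
  consider "\<not> set w \<subseteq> multi_index d l" | "length w \<noteq> l" | "w \<in> words (multi_index d l) l" by blast
  then show "ext_act d l As (cayley d l) w = (\<Prod>j<d. \<Prod>i<l. (As ! j) $$ (i, i)) * cayley d l w"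
  proof cases
    case 1
    then show ?thesis using assms by (simp add: cayley_eq ext_act_outside)
  next
    case 2
    then have "cayley d l u = 0" if "length u = length w" for u
      using that d assms by (auto simp: cayley_eq levi_civita_def)
    then show ?thesis by (simp add: ext_act_words)
  next
    case 3
    then have len: "length w = l" by simp
    have "ext_act d l As (cayley d l) w = (\<Sum>u\<in>words (multi_index d l) l. \<Prod>j<d. 
        (\<Prod>k<l. (As ! j) $$ (column j w ! k, column j u ! k)) * levi_civita l (column j u)) * fact l"
      using 3 assms unfolding sum_distrib_right
      by (auto simp: ext_act_words tensor_entry_def cayley_eq prod.distrib prod.swap[of _ "{..<l}" "{..<d}"]
          intro!: sum.cong)
    also have "\<dots> = (\<Prod>j<d. minor_sum l (As ! j) (column j w)) * fact l"
      by (subst sum_prod_columns[where F = "\<lambda>j c. (\<Prod>k<l. (As ! j) $$ (column j w ! k, c ! k)) * levi_civita l c"])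
        (simp add: minor_sum_def len)
    also have "\<dots> = (\<Prod>j<d. (\<Prod>i<l. (As ! j) $$ (i, i)) * levi_civita l (column j w)) * fact l"
      using assms column_in_words[OF 3] len
      by (intro arg_cong2[where f = "(*)"] prod.cong refl minor_sum_upper_triangular) auto
    finally show ?thesis using 3 assms by (simp add: cayley_eq prod.distrib)
  qed
qed

section \<open>Wedging highest weight vectors with the Cayley form\<close>

lemma ext_alg_iff: "f \<in> ext_alg d l \<longleftrightarrow> (\<forall>w. \<not> set w \<subseteq> multi_index d l \<longrightarrow> f w = 0) \<and> alternating f"
  unfolding ext_alg_def alternating_def by blast

text \<open>Permuting a word contributes one sign per column, and an odd power of a sign is the sign
  itself.\<close>

lemma cayley_in_ext_alg:
  assumes "odd d" shows "cayley d l \<in> ext_alg d l"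
  unfolding ext_alg_iff alternating_def
proof (intro conjI allI impI)
  fix w \<pi> assume \<pi>: "\<pi> permutes {..<length (w :: nat list list)}"
  have "levi_civita l (column j (permute_list \<pi> w)) = of_int (sign \<pi>) * levi_civita l (column j w)" for j
    using alternatingD[OF alternating_levi_civita, of \<pi> "column j w" l] \<pi> by (simp add: permute_list_column)
  moreover have "of_int (sign \<pi>) ^ d = (of_int (sign \<pi>) :: complex)"
    using assms by (cases \<pi> rule: sign_cases) simp_all
  ultimately show "cayley d l (permute_list \<pi> w) = of_int (sign \<pi>) * cayley d l w"
    using \<pi> by (simp add: cayley_eq[OF assms] prod.distrib)
qed (simp add: cayley_eq[OF assms])

lemma wedge_in_ext_alg:
  "f \<in> ext_alg d l \<Longrightarrow> g \<in> ext_alg d l \<Longrightarrow> wedge f g \<in> ext_alg d l"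
  unfolding ext_alg_iff using alternating_wedge wedge_outside[of "multi_index d l" f g] by blast

lemma ext_act_diag:
  assumes "set w \<subseteq> multi_index d l"
  shows "ext_act d l (map (\<lambda>j. mat_diag l (a j)) [0..<d]) v w
     = (\<Prod>k<length w. \<Prod>j<d. a j (w ! k ! j)) * v w"
  using assms
proof (induction w arbitrary: v)
  case (Cons b w)
  let ?D = "map (\<lambda>j. mat_diag l (a j)) [0..<d]"
  have entry: "tensor_entry ?D b c = (if c = b then \<Prod>j<d. a j (b ! j) else 0)"
    if c: "c \<in> multi_index d l" for c
  proof -
    have bnd: "b ! j < l" "c ! j < l" if "j < d" for j
      using that c Cons.prems unfolding multi_index_def by (auto simp: subset_iff)
    have "tensor_entry ?D b c = (\<Prod>j<d. if b ! j = c ! j then a j (b ! j) else 0)"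
      unfolding tensor_entry_def using bnd by (auto simp: mat_diag_def intro!: prod.cong)
    moreover have "\<exists>j<d. b ! j \<noteq> c ! j" if "c \<noteq> b"
      using that c Cons.prems unfolding multi_index_def by (auto simp: list_eq_iff_nth_eq)
    ultimately show ?thesis by (auto intro!: prod_zero)
  qed
  have "ext_act d l ?D v (b # w) = (\<Sum>c\<in>multi_index d l.
      if c = b then (\<Prod>j<d. a j (b ! j)) * ext_act d l ?D (\<lambda>u. v (c # u)) w else 0)"
    using Cons.prems by (subst ext_act_Cons) (auto simp: entry intro!: sum.cong)
  also have "\<dots> = (\<Prod>j<d. a j (b ! j)) * ext_act d l ?D (\<lambda>u. v (b # u)) w"
    using Cons.prems by (simp add: sum.delta finite_multi_index)
  finally show ?case
    using Cons by (simp add: prod.lessThan_Suc_shift mult.assoc del: prod.lessThan_Suc)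
qed simp

text \<open>Take the diagonal tuple with entry \<open>2\<close> at coordinate \<open>i\<close> of
  factor \<open>j\<close> and \<open>1\<close> elsewhere. By its weight, \<open>v\<close> is fixed,
  yet the coefficient at \<open>w\<close> is multiplied by a power of \<open>2\<close>, a proper one
  as \<open>i\<close> occurs in the column.\<close>

lemma weight_vector_support:
  assumes wv: "weight_vector d l mu v" and "mu j i = 0" and "j < d"
    and w: "set w \<subseteq> multi_index d l" and "i \<in> set (column j w)"
  shows "v w = 0"
proof -
  define a :: "nat \<Rightarrow> nat \<Rightarrow> complex" where "a j' i' = (if j' = j \<and> i' = i then 2 else 1)" for j' i'
  \<comment> \<open>The scalar is formed in the natural numbers, where divisibility by
    \<open>2\<close> rules out the value \<open>1\<close>.\<close>
  define N :: nat where "N = (\<Prod>k<length w. \<Prod>j'<d. if j' = j \<and> w ! k ! j' = i then 2 else 1)"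
  obtain k where k: "k < length w" "w ! k ! j = i"
    using assms(5) by (auto simp: column_def in_set_conv_nth)
  have "(2::nat) dvd (\<Prod>j'<d. if j' = j \<and> w ! k ! j' = i then 2 else 1)"
    using k \<open>j < d\<close> by (intro dvd_prodI[THEN dvd_trans[rotated]]) auto
  also have "\<dots> dvd N" unfolding N_def using k by (intro dvd_prodI) auto
  finally have N: "N \<noteq> 1" by auto
  have "(\<Prod>j'<d. \<Prod>i'<l. a j' i' powi mu j' i') = 1"
    using assms(2) by (intro prod.neutral ballI) (auto simp: a_def)
  moreover have "\<forall>j<d. \<forall>i<l. a j i \<noteq> 0" by (simp add: a_def)
  ultimately have "ext_act d l (map (\<lambda>j. mat_diag l (a j)) [0..<d]) v w = v w"
    using wv unfolding weight_vector_def by (simp add: fscale_def)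
  moreover have "(\<Prod>k<length w. \<Prod>j<d. a j (w ! k ! j)) = of_nat N"
    unfolding N_def of_nat_prod by (intro prod.cong refl) (auto simp: a_def)
  ultimately have "of_nat N * v w = v w" using ext_act_diag[OF w] by metis
  then show ?thesis using N by (metis mult_cancel_right2 of_nat_eq_1_iff)
qed

text \<open>No letter of \<open>w\<close> can go to \<open>g\<close>, so all of them go to
  \<open>f\<close>, in front and without a sign.\<close>

lemma wedge_append_avoid:
  assumes "\<And>u. \<not> set u \<subseteq> B \<Longrightarrow> g u = 0" and "set w \<inter> B = {}"
  shows "wedge f g (w @ u) = wedge (\<lambda>x. f (w @ x)) g u"
  using assms(2)
proof (induction w arbitrary: f)
  case (Cons a w)
  then have "g (a # u) = 0" for u using assms(1) by simp
  then show ?case using Cons by (simp add: wedge_Cons wedge_zero_right)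
qed simp

text \<open>Since \<open>l > 2\<close>, three coordinates suffice to choose a term of the Cayley form none of whose
  letters lies in the standard basis of \<open>V\<^sub>2\<close>: take the permutations \<open>id\<close>, \<open>(0 2)\<close> and \<open>(1 2)\<close>.\<close>

lemma cayley_wedge_word:
  assumes "odd d" and "d \<ge> 3" and "l > 2"
  obtains w where "w \<in> words (multi_index d l) l" and "cayley d l w \<noteq> 0"
    and "\<forall>v. (\<forall>u. \<not> set u \<subseteq> multi_index d 2 \<longrightarrow> v u = 0) \<longrightarrow>
       (\<forall>u. wedge (cayley d l) v (w @ u) = cayley d l w * v u)"
proof -
  define p :: "nat \<Rightarrow> nat \<Rightarrow> nat" where
    "p j = (if j = 1 then transpose 0 2 else if j = 2 then transpose 1 2 else id)" for j
  define w where "w = map (\<lambda>k. map (\<lambda>j. p j k) [0..<d]) [0..<l]"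
  have p: "p j permutes {..<l}" for j
    using assms(3) by (auto simp: p_def permutes_id intro!: permutes_swap_id)
  then have "p j k < l" if "k < l" for j k
    using that permutes_in_image[of "p j" "{..<l}" k] by simp
  then have w: "w \<in> words (multi_index d l) l" by (auto simp: w_def multi_index_def)
  have "column j w = map (p j) [0..<l]" if "j < d" for j
    using that by (simp add: column_def w_def)
  then have ne: "cayley d l w \<noteq> 0"
    using w levi_civita_permutation[OF p] by (simp add: cayley_eq[OF assms(1)])
  have "map (\<lambda>j. p j k) [0..<d] \<notin> multi_index d 2" if "k < l" for k
  proof
    assume "map (\<lambda>j. p j k) [0..<d] \<in> multi_index d 2"
    then have "set (map (\<lambda>j. p j k) [0..<d]) \<subseteq> {..<2}" by (simp add: multi_index_def)
    then have "p j k < 2" if "j < d" for j using that by fastforce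
    \<comment> \<open>Coordinate \<open>0\<close> forces \<open>k < 2\<close>, but coordinate
      \<open>1\<close> takes \<open>0\<close> to \<open>2\<close> and coordinate \<open>2\<close>
      takes \<open>1\<close> to \<open>2\<close>.\<close>
    from this[of 0] this[of 1] this[of 2] show False
      using assms(2) by (auto simp: p_def transpose_def split: if_splits)
  qed
  then have avoid: "set w \<inter> multi_index d 2 = {}" by (auto simp: w_def)
  \<comment> \<open>The form is homogeneous of degree \<open>l\<close>: once it has received
    \<open>w\<close>, it accepts no further letter and acts as a multiple of the unit
    \<open>delta []\<close>.\<close>
  have "cayley d l (w @ x) = cayley d l w * delta [] x" for x
    using w assms by (cases x) (auto simp: cayley_eq delta_def levi_civita_def column_append)
  then have "wedge (cayley d l) v (w @ u) = cayley d l w * v u"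
    if "\<forall>u. \<not> set u \<subseteq> multi_index d 2 \<longrightarrow> v u = 0" for v u
    using wedge_append_avoid[of "multi_index d 2" v w, OF _ avoid] that
    by (simp add: wedge_scale_left wedge_delta_Nil)
  then show ?thesis using that w ne by blast
qed

section \<open>Weights of conjugate partitions\<close>

lemma conj_partition_nth:
  assumes "sorted_wrt (\<ge>) p"
  shows "(if i < length (conj_partition p) then conj_partition p ! i else 0)
     = length (filter (\<lambda>x. i < x) p)"
proof (cases p)
  case (Cons x q)
  \<comment> \<open>The first part is the largest, so past the end of the conjugate partition the
    count is \<open>0\<close>, like the padding.\<close>
  have "filter (\<lambda>y. i < y) p = []" if "\<not> i < x"
    using assms that by (auto simp: Cons filter_empty_conv)
  then show ?thesis by (auto simp: conj_partition_def Cons)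
qed (simp add: conj_partition_def)

lemma weight_of_conj:
  assumes "j < length ps" and "sorted_wrt (\<ge>) (ps ! j)"
  shows "weight_of (map conj_partition ps) j i = int (length (filter (\<lambda>x. i < x) (ps ! j)))"
  using assms by (simp add: weight_of_def conj_partition_nth[symmetric])

text \<open>The new part \<open>l\<close> exceeds every \<open>i < l\<close>, so it lengthens each
  of these columns by one.\<close>

lemma weight_of_conj_rho:
  assumes "j < length ps" and "sorted_wrt (\<ge>) (ps ! j)" and "\<forall>x\<in>set (ps ! j). x \<le> l" and "i < l"
  shows "weight_of (map conj_partition (map (rho l) ps)) j i
     = weight_of (map conj_partition ps) j i + 1"
proof -
  have "sorted_wrt (\<ge>) (map (rho l) ps ! j)" using assms by (simp add: rho_def)
  then show ?thesis using assms weight_of_conj[of j "map (rho l) ps" i]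
    by (simp add: weight_of_conj rho_def)
qed

text \<open>The action is multiplicative, and the Cayley form contributes the product of all
  diagonal entries: one more power of each \<open>a j i\<close> for the torus, and the factor
  \<open>1\<close> for unitriangular tuples.\<close>

lemma cayley_wedge_HWV:
  assumes "odd d" and v: "v \<in> HWV d l mu"
    and mu': "\<And>j i. j < d \<Longrightarrow> i < l \<Longrightarrow> mu' j i = mu j i + 1"
  shows "wedge (cayley d l) v \<in> HWV d l mu'"
proof -
  let ?c = "cayley d l"
  have act: "ext_act d l As (wedge ?c v)
      = fscale (\<Prod>j<d. \<Prod>i<l. (As ! j) $$ (i, i)) (wedge ?c (ext_act d l As v))"
    if "length As = d" "\<And>A. A \<in> set As \<Longrightarrow> A \<in> carrier_mat l l \<and> upper_triangular A" for As
    by (rule ext) (simp only: ext_act_wedge ext_act_cayley[OF assms(1) that] wedge_scale_left fscale_def)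
  have "weight_vector d l mu' (wedge ?c v)"
    unfolding weight_vector_def
  proof (intro allI impI)
    fix a :: "nat \<Rightarrow> nat \<Rightarrow> complex" assume a: "\<forall>j<d. \<forall>i<l. a j i \<noteq> 0"
    let ?D = "map (\<lambda>j. mat_diag l (a j)) [0..<d]"
    have powi: "(\<Prod>j<d. \<Prod>i<l. a j i powi mu' j i)
        = (\<Prod>j<d. \<Prod>i<l. a j i) * (\<Prod>j<d. \<Prod>i<l. a j i powi mu j i)"
      unfolding prod.distrib[symmetric] using a
      by (intro prod.cong refl) (simp add: mu' power_int_add_1')
    have "ext_act d l ?D v = fscale (\<Prod>j<d. \<Prod>i<l. a j i powi mu j i) v"
      using v a unfolding HWV_def weight_vector_def by blast
    moreover have "(\<Prod>j<d. \<Prod>i<l. (?D ! j) $$ (i, i)) = (\<Prod>j<d. \<Prod>i<l. a j i)"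
      by (simp add: mat_diag_def)
    moreover have "ext_act d l ?D (wedge ?c v)
        = fscale (\<Prod>j<d. \<Prod>i<l. (?D ! j) $$ (i, i)) (wedge ?c (ext_act d l ?D v))"
      by (rule act) (auto simp: mat_diag_def upper_triangular_def)
    ultimately have "ext_act d l ?D (wedge ?c v) = fscale (\<Prod>j<d. \<Prod>i<l. a j i)
        (wedge ?c (fscale (\<Prod>j<d. \<Prod>i<l. a j i powi mu j i) v))"
      by (simp only:)
    then show "ext_act d l ?D (wedge ?c v)
        = fscale (\<Prod>j<d. \<Prod>i<l. a j i powi mu' j i) (wedge ?c v)"
      unfolding powi by (simp add: fun_eq_iff fscale_def wedge_scale_right mult.assoc)
  qed
  moreover have "ext_act d l As (wedge ?c v) = wedge ?c v"
    if "length As = d" "set As \<subseteq> upper_unitriangular l" for As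
  proof -
    have "(As ! j) $$ (i, i) = 1" if "j < d" "i < l" for i j
      using that \<open>length As = d\<close> \<open>set As \<subseteq> _\<close> nth_mem[of j As] unfolding upper_unitriangular_def by blast
    then have "(\<Prod>j<d. \<Prod>i<l. (As ! j) $$ (i, i)) = 1" by (intro prod.neutral ballI) simp
    moreover have "ext_act d l As v = v" using v that unfolding HWV_def by blast
    moreover have "ext_act d l As (wedge ?c v)
        = fscale (\<Prod>j<d. \<Prod>i<l. (As ! j) $$ (i, i)) (wedge ?c (ext_act d l As v))"
      using that by (intro act) (auto simp: upper_unitriangular_def)
    ultimately show ?thesis by (simp add: fscale_def)
  qed
  moreover have "wedge ?c v \<in> ext_alg d l"
    using v cayley_in_ext_alg[OF assms(1)] by (intro wedge_in_ext_alg) (simp_all add: HWV_def)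
  ultimately show ?thesis unfolding HWV_def by blast
qed

text \<open>A basis letter outside \<open>V\<^sub>2\<close> has a coordinate
  \<open>i \<ge> 2\<close>, where the weight is \<open>0\<close>;
  \<open>weight_vector_support\<close> applies.\<close>

lemma HWV_support:
  assumes "v \<in> HWV d l mu" and "\<And>j i. j < d \<Longrightarrow> i \<ge> 2 \<Longrightarrow> mu j i = 0" and "\<not> set u \<subseteq> multi_index d 2"
  shows "v u = 0"
proof (cases "set u \<subseteq> multi_index d l")
  case False
  then show ?thesis using assms(1) by (simp add: HWV_def ext_alg_def)
next
  case True
  obtain b where b: "b \<in> set u" "b \<notin> multi_index d 2" using assms(3) by blast
  then have "length b = d" using True by (auto simp: multi_index_def)
  then obtain x where "x \<in> set b" "\<not> x < 2" using b by (auto simp: multi_index_def)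
  then obtain j where "j < d" "\<not> b ! j < 2" using \<open>length b = d\<close> by (auto simp: in_set_conv_nth)
  then show ?thesis
    using weight_vector_support[of d l mu v j "b ! j" u] assms b True
    by (simp add: HWV_def column_def)
qed

text \<open>The coefficients of the product at the words \<open>w @ u\<close> give back
  \<open>v u\<close> up to the nonzero factor \<open>cayley d l w\<close>.\<close>

lemma cayley_wedge_inj_on_HWV:
  assumes "odd d" and "d \<ge> 3" and "l > 2" and "\<And>j i. j < d \<Longrightarrow> i \<ge> 2 \<Longrightarrow> mu j i = 0"
  shows "inj_on (\<lambda>v. wedge (cayley d l) v) (HWV d l mu)"
proof (rule inj_onI)
  fix v v' assume v: "v \<in> HWV d l mu" "v' \<in> HWV d l mu" and eq: "wedge (cayley d l) v = wedge (cayley d l) v'"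
  obtain w where "w \<in> words (multi_index d l) l" and w: "cayley d l w \<noteq> 0"
    and wedge: "\<forall>v. (\<forall>u. \<not> set u \<subseteq> multi_index d 2 \<longrightarrow> v u = 0) \<longrightarrow>
       (\<forall>u. wedge (cayley d l) v (w @ u) = cayley d l w * v u)"
    by (rule cayley_wedge_word[OF assms(1-3)])
  show "v = v'"
  proof
    fix u
    have support: "\<forall>u. \<not> set u \<subseteq> multi_index d 2 \<longrightarrow> x u = 0" if "x \<in> HWV d l mu" for x
      using HWV_support[OF that] assms(4) by simp
    have "wedge (cayley d l) v (w @ u) = cayley d l w * v u"
      "wedge (cayley d l) v' (w @ u) = cayley d l w * v' u"
      using wedge support v by simp_all
    then have "cayley d l w * v u = cayley d l w * v' u" unfolding eq by (simp only:)
    then show "v u = v' u" using w by simp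
  qed
qed

section \<open>Splitting words along masks\<close>

text \<open>A mask encodes a position set as a list of truth values, so that a word and its
  splitting can be taken apart in step.\<close>

fun select :: "bool list \<Rightarrow> 'a list \<Rightarrow> 'a list" where
  "select (b # bs) (x # xs) = (if b then x # select bs xs else select bs xs)"
| "select _ _ = []"

text \<open>The shuffle sign of the set of positions marked \<open>True\<close>: each
  \<open>False\<close> is inverted with every later \<open>True\<close>.\<close>

fun mask_sign :: "bool list \<Rightarrow> complex" where
  "mask_sign [] = 1"
| "mask_sign (b # bs) = (if b then 1 else (-1) ^ count_list bs True) * mask_sign bs"

lemma length_select: "length bs = length xs \<Longrightarrow> length (select bs xs) = count_list bs True"
  by (induction bs xs rule: select.induct) auto

lemma count_list_Not: "count_list (map Not bs) True + count_list bs True = length bs"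
  by (induction bs) auto

lemma set_select_subset: "set (select bs xs) \<subseteq> set xs"
  by (induction bs xs rule: select.induct) auto

lemma column_select: "column j (select bs w) = select bs (column j w)"
  by (induction bs w rule: select.induct) auto

lemma mask_sign_cases: "mask_sign bs = 1 \<or> mask_sign bs = -1"
  by (induction bs) (auto simp: minus_one_power_iff)

lemma sum_masks_Suc:
  fixes F :: "bool list \<Rightarrow> complex"
  shows "(\<Sum>bs\<in>words UNIV (Suc n). F bs)
     = (\<Sum>bs\<in>words UNIV n. F (True # bs)) + (\<Sum>bs\<in>words UNIV n. F (False # bs))"
proof -
  have "(\<Sum>b\<in>UNIV. G b) = G True + G False" for G :: "bool \<Rightarrow> complex"
    by (simp add: UNIV_bool add.commute)
  then show ?thesis unfolding sum_words_Suc .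
qed

text \<open>This follows \<open>wedge_Cons\<close>: \<open>True\<close> hands the first letter to
  \<open>f\<close>, \<open>False\<close> to \<open>g\<close>, and the degree sign becomes the count
  in \<open>mask_sign\<close>.\<close>

lemma wedge_masks:
  "wedge f g w = (\<Sum>bs\<in>words UNIV (length w).
     mask_sign bs * f (select bs w) * g (select (map Not bs) w))"
proof (induction w arbitrary: f g)
  case Nil
  have "words (UNIV :: bool set) 0 = {[]}" by auto
  then show ?case by simp
next
  case (Cons a w)
  have "wedge (\<lambda>u. (-1) ^ length u * f u) (\<lambda>u. g (a # u)) w
      = (\<Sum>bs\<in>words UNIV (length w). mask_sign (False # bs) * f (select (False # bs) (a # w))
          * g (select (map Not (False # bs)) (a # w)))"
    unfolding Cons by (intro sum.cong) (auto simp: length_select)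
  then show ?case
    unfolding wedge_Cons Cons list.size add_0_right add_Suc_right sum_masks_Suc by simp
qed

text \<open>The row word of a tableau with a new first row: marked entries go to row
  \<open>0\<close>, the others keep their row from \<open>r\<close>, moved down by one.\<close>

fun merge_rows :: "bool list \<Rightarrow> nat list \<Rightarrow> nat list" where
  "merge_rows (True # bs) r = 0 # merge_rows bs r"
| "merge_rows (False # bs) (a # r) = Suc a # merge_rows bs r"
| "merge_rows _ _ = []"

lemma length_merge_rows:
  "length r = count_list (map Not bs) True \<Longrightarrow> length (merge_rows bs r) = length bs"
  by (induction bs r rule: merge_rows.induct) auto

text \<open>The mask and \<open>c\<close> have one letter per position, while \<open>r\<close> has
  one per \<open>False\<close> only, so \<open>r\<close> gets shorter only at unmarked
  positions.\<close>

lemma merge_rows_induct [consumes 2, case_names Nil True False]: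
  assumes "length bs = length c" and "length r = count_list (map Not bs) True"
    and "P [] [] []"
    and "\<And>bs x c r. length bs = length c \<Longrightarrow> length r = count_list (map Not bs) True \<Longrightarrow>
      P bs c r \<Longrightarrow> P (True # bs) (x # c) r"
    and "\<And>bs x c a r. length bs = length c \<Longrightarrow> length r = count_list (map Not bs) True \<Longrightarrow>
      P bs c r \<Longrightarrow> P (False # bs) (x # c) (a # r)"
  shows "P bs c r"
  using assms(1,2)
proof (induction bs arbitrary: c r)
  case Nil
  then show ?case using assms(3) by simp
next
  case (Cons b bs)
  then obtain x c' where c: "c = x # c'" by (cases c) auto
  show ?case
  proof (cases b)
    case True
    then show ?thesis using Cons c assms(4) by simp
  next
    case False
    then obtain a r' where "r = a # r'" using Cons.prems by (cases r) auto
    then show ?thesis using False Cons c assms(5) by simp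
  qed
qed

lemma prod_list_zip_merge_rows:
  assumes "length bs = length c" and "length r = count_list (map Not bs) True"
  shows "(\<Prod>y\<leftarrow>zip (merge_rows bs r) c. g y)
     = (\<Prod>b\<leftarrow>select bs c. g (0, b)) * (\<Prod>(a, b)\<leftarrow>zip r (select (map Not bs) c). g (Suc a, b) :: complex)"
  using assms by (induction rule: merge_rows_induct) (simp_all add: mult_ac)

lemma set_zip_merge_rows:
  assumes "length bs = length c" and "length r = count_list (map Not bs) True"
  shows "set (zip (merge_rows bs r) c)
     = Pair 0 ` set (select bs c) \<union> map_prod Suc id ` set (zip r (select (map Not bs) c))"
  using assms by (induction rule: merge_rows_induct) auto

text \<open>In lexicographic order, row \<open>0\<close> precedes all other rows. Inversions lie
  within the first row, within the rest, or between the two, and those of the last kind are counted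
  by \<open>mask_sign\<close>.\<close>

lemma list_sign_merge_rows:
  assumes "length bs = length c" and "length r = count_list (map Not bs) True"
  shows "list_sign (zip (merge_rows bs r) c)
     = mask_sign bs * list_sign (select bs c) * list_sign (zip r (select (map Not bs) c))"
  using assms
proof (induction rule: merge_rows_induct)
  case (True bs x c r)
  have "(\<Prod>(a, b)\<leftarrow>xs. if (0, x) < (Suc a, b) then 1 else if (Suc a, b) < (0, x) then -1 else (0::complex)) = 1"
    for xs
    by (induction xs) auto
  with True show ?case by (simp add: prod_list_zip_merge_rows cong: if_cong)
next
  case (False bs x c a r)
  have "(\<Prod>b\<leftarrow>xs. if (Suc a, x) < (0, b) then 1 else if (0, b) < (Suc a, x) then -1 else (0::complex))
      = (-1) ^ length xs" for xs
    by (induction xs) auto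
  with False show ?case
    by (simp add: prod_list_zip_merge_rows length_select split_def mult_ac less_prod_def cong: if_cong)
qed simp


section \<open>Specht modules as column spaces\<close>

text \<open>Entry \<open>k\<close> lies in box \<open>(r ! k, c ! k)\<close>. As there are as many
  entries as boxes, a word that covers the diagram uses no box twice.\<close>

definition specht_entry :: "nat list \<Rightarrow> nat list \<Rightarrow> nat list \<Rightarrow> complex" where
  "specht_entry p r c =
     (if length r = sum_list p \<and> length c = sum_list p \<and> set (zip r c) = diagram p
      then list_sign (zip r c) else 0)"

lemma cnj_specht_entry [simp]: "cnj (specht_entry p r c) = specht_entry p r c"
  by (simp add: specht_entry_def)

lemma specht_entry_permute:
  assumes "\<pi> permutes {..<sum_list p}"
  shows "specht_entry p (permute_list \<pi> r) (permute_list \<pi> c) = of_int (sign \<pi>) * specht_entry p r c"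
proof (cases "length r = sum_list p \<and> length c = sum_list p")
  case True
  then have \<pi>: "\<pi> permutes {..<length (zip r c)}" using assms by simp
  have zip: "zip (permute_list \<pi> r) (permute_list \<pi> c) = permute_list \<pi> (zip r c)"
    using True assms by (intro permute_list_zip[symmetric, of \<pi> "{..<sum_list p}"]) simp_all
  show ?thesis
    unfolding specht_entry_def length_permute_list zip set_permute_list[OF \<pi>]
      alternatingD[OF alternating_list_sign \<pi>] by simp
qed (auto simp: specht_entry_def)

lemma specht_entry_nonzero:
  assumes "specht_entry p r c \<noteq> 0"
  shows "length r = sum_list p" and "length c = sum_list p" and "set (zip r c) = diagram p"
    and "distinct (zip r c)"
  using assms alternating_repeat[OF alternating_list_sign, of "zip r c"]
  by (auto simp: specht_entry_def split: if_splits)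

lemma diagram_Cons: "diagram (l # p) = Pair 0 ` {..<l} \<union> map_prod Suc id ` diagram p"
proof (unfold set_eq_iff split_paired_All, intro allI)
  fix r c
  show "(r, c) \<in> diagram (l # p) \<longleftrightarrow> (r, c) \<in> Pair 0 ` {..<l} \<union> map_prod Suc id ` diagram p"
    by (cases r) (auto simp: diagram_def image_iff)
qed

text \<open>The diagram of \<open>l # p\<close> is a first row of length \<open>l\<close> above a
  shifted copy of that of \<open>p\<close>. The marked entries have to fill the first row and the
  others the copy, and the sign splits accordingly.\<close>

lemma specht_entry_merge_rows:
  assumes "length bs = length c" and "length c = l + sum_list p" and "count_list bs True = l"
    and "length r = sum_list p"
  shows "specht_entry (l # p) (merge_rows bs r) c
     = mask_sign bs * levi_civita l (select bs c) * specht_entry p r (select (map Not bs) c)"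
proof -
  have count: "count_list (map Not bs) True = sum_list p" using count_list_Not[of bs] assms by simp
  note r = assms(1) trans[OF assms(4) count[symmetric]]
  \<comment> \<open>The row index, \<open>0\<close> or a successor, tells which part a box comes
    from, so the parts of the union can be compared separately.\<close>
  have disj: "Pair 0 ` A \<union> map_prod Suc id ` B = Pair 0 ` A' \<union> map_prod Suc id ` B' \<longleftrightarrow> A = A' \<and> B = B'"
    for A A' :: "nat set" and B B' :: "(nat \<times> nat) set"
  proof
    assume eq: "Pair 0 ` A \<union> map_prod Suc id ` B = Pair 0 ` A' \<union> map_prod Suc id ` B'"
    have A: "X = {x. (0, x) \<in> Pair 0 ` X \<union> map_prod Suc id ` Y}"
      and B: "Y = {(a, b). (Suc a, b) \<in> Pair 0 ` X \<union> map_prod Suc id ` Y}"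
      for X :: "nat set" and Y :: "(nat \<times> nat) set"
      by force+
    show "A = A' \<and> B = B'"
      using A[of A B] A[of A' B'] B[of B A] B[of B' A'] unfolding eq by simp
  qed simp
  have "set (zip (merge_rows bs r) c) = diagram (l # p) \<longleftrightarrow>
      set (select bs c) = {..<l} \<and> set (zip r (select (map Not bs) c)) = diagram p"
    unfolding set_zip_merge_rows[OF r] diagram_Cons by (rule disj)
  then show ?thesis
    using assms count r list_sign_merge_rows[OF r]
    by (simp add: specht_entry_def levi_civita_def length_select length_merge_rows)
qed

text \<open>A tabloid \<open>t\<close> occurs in the polytabloid just when \<open>t\<close> and the
  column word of \<open>T\<close> together fill the diagram. Then exactly one column permutation
  carries it to the tabloid of \<open>T\<close>, and its sign is the product of the signs of the two
  words of boxes.\<close>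

lemma polytabloid_eq:
  assumes T: "T \<in> tableaux p"
  defines "Tw \<equiv> map T [0..<sum_list p]"
  shows "polytabloid p T t = list_sign Tw * specht_entry p t (map snd Tw)"
proof -
  define n where "n = sum_list p"
  define c where "c = map snd Tw"
  have len: "length Tw = n" "length c = n" by (simp_all add: Tw_def n_def c_def)
  have bij: "bij_betw T {..<n} (diagram p)" using T by (simp add: tableaux_def n_def)
  have Tw: "distinct Tw" "set Tw = diagram p"
    using bij by (auto simp: Tw_def n_def distinct_map bij_betw_def atLeast0LessThan)
  have poly: "polytabloid p T t = (\<Sum>\<sigma>\<in>column_stabilizer p T.
      of_int (sign \<sigma>) * (if permute_list \<sigma> t = map fst Tw then 1 else 0))"
    by (simp add: polytabloid_def sum_fun_apply fscale_def tabloid_act_def delta_def tabloid_def Tw_def comp_def)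
  have stab: "\<sigma> \<in> column_stabilizer p T \<longleftrightarrow> \<sigma> permutes {..<n} \<and> permute_list \<sigma> c = c" for \<sigma>
  proof (cases "\<sigma> permutes {..<n}")
    case True
    then have "\<sigma> k < n" if "k < n" for k using that permutes_in_image[of \<sigma> "{..<n}" k] by simp
    then have "permute_list \<sigma> c = c \<longleftrightarrow> (\<forall>k<n. snd (T (\<sigma> k)) = snd (T k))"
      using True len by (auto simp: list_eq_iff_nth_eq permute_list_nth c_def Tw_def n_def)
    then show ?thesis using True by (simp add: column_stabilizer_def n_def)
  qed (simp add: column_stabilizer_def n_def)
  \<comment> \<open>A column permutation fixes the column word, so rearranging row words amounts to
    rearranging whole words of boxes.\<close>
  have key: "permute_list \<sigma> (zip t c) = Tw \<longleftrightarrow> permute_list \<sigma> t = map fst Tw \<and> permute_list \<sigma> c = c"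
    if "\<sigma> permutes {..<n}" "length t = n" for \<sigma>
  proof -
    have "permute_list \<sigma> (zip t c) = zip (permute_list \<sigma> t) (permute_list \<sigma> c)"
      using that len by (intro permute_list_zip[of \<sigma> "{..<n}"]) auto
    moreover have "zip xs ys = Tw \<longleftrightarrow> xs = map fst Tw \<and> ys = c" if "length xs = n" "length ys = n" for xs ys
      using that unfolding c_def by (metis map_fst_zip map_snd_zip zip_map_fst_snd)
    ultimately show ?thesis using that len by simp
  qed
  show ?thesis
  proof (cases "length t = n \<and> distinct (zip t c) \<and> set (zip t c) = diagram p")
    case True
    then have "mset (zip t c) = mset Tw" using Tw set_eq_iff_mset_eq_distinct by metis
    then obtain \<sigma> where \<sigma>: "\<sigma> permutes {..<length (zip t c)}" "permute_list \<sigma> (zip t c) = Tw"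
      using mset_eq_permutation by metis
    then have \<sigma>': "\<sigma> permutes {..<n}" using True len by simp
    \<comment> \<open>The boxes in \<open>zip t c\<close> are distinct, so only one permutation can
      rearrange them into \<open>Tw\<close>.\<close>
    have uniq: "\<tau> = \<sigma>" if \<tau>: "\<tau> permutes {..<n}" "permute_list \<tau> (zip t c) = Tw" for \<tau>
    proof
      fix k
      show "\<tau> k = \<sigma> k"
      proof (cases "k < n")
        case k: True
        have "\<tau> k < n" "\<sigma> k < n"
          using k \<tau>(1) \<sigma>' permutes_in_image[of _ "{..<n}" k] by auto
        moreover have "zip t c ! \<tau> k = zip t c ! \<sigma> k"
          using \<tau> \<sigma> \<sigma>' k True len permute_list_nth[of \<tau> "zip t c" k] permute_list_nth[of \<sigma> "zip t c" k]
          by simp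
        ultimately show ?thesis using True len nth_eq_iff_index_eq[of "zip t c"] by simp
      next
        case False
        then show ?thesis using \<tau>(1) \<sigma>' by (simp add: permutes_not_in)
      qed
    qed
    have "polytabloid p T t = (\<Sum>\<tau>\<in>column_stabilizer p T. if \<tau> = \<sigma> then of_int (sign \<sigma>) else 0)"
      unfolding poly
    proof (rule sum.cong[OF refl])
      fix \<tau> assume "\<tau> \<in> column_stabilizer p T"
      then have \<tau>: "\<tau> permutes {..<n}" "permute_list \<tau> c = c" by (simp_all add: stab)
      then have "permute_list \<tau> t = map fst Tw \<longleftrightarrow> \<tau> = \<sigma>"
        using key[OF \<tau>(1)] uniq[OF \<tau>(1)] \<sigma>(2) True by blast
      then show "of_int (sign \<tau>) * (if permute_list \<tau> t = map fst Tw then 1 else 0)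
          = (if \<tau> = \<sigma> then of_int (sign \<sigma>) else (0::complex))" by simp
    qed
    moreover have "\<sigma> \<in> column_stabilizer p T" using key[OF \<sigma>'] \<sigma>(2) \<sigma>' True by (simp add: stab)
    moreover have "finite (column_stabilizer p T)"
      by (rule finite_subset[OF _ finite_permutations[of "{..<n}"]]) (auto simp: stab)
    ultimately have "polytabloid p T t = of_int (sign \<sigma>)" by (simp add: sum.delta)
    moreover have "list_sign Tw = of_int (sign \<sigma>) * list_sign (zip t c)"
      using alternatingD[OF alternating_list_sign \<sigma>(1)] \<sigma>(2) by simp
    ultimately show ?thesis
      using True len list_sign_square[of "zip t c"]
      by (simp add: specht_entry_def c_def[symmetric] n_def mult.assoc)
  next
    case False
    have "permute_list \<tau> t \<noteq> map fst Tw" if "\<tau> \<in> column_stabilizer p T" for \<tau>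
    proof
      assume eq: "permute_list \<tau> t = map fst Tw"
      then have "length t = n" using len by (metis length_map length_permute_list)
      moreover from this have "permute_list \<tau> (zip t c) = Tw" using eq that key by (simp add: stab)
      moreover have "\<tau> permutes {..<length (zip t c)}" using that calculation len by (simp add: stab)
      ultimately show False
        using False Tw distinct_permute_list[of \<tau> "zip t c"] set_permute_list[of \<tau> "zip t c"] by simp
    qed
    then have "polytabloid p T t = 0" unfolding poly by (intro sum.neutral) simp
    moreover have "specht_entry p t c = 0" using False specht_entry_nonzero[of p t c] n_def by blast
    ultimately show ?thesis by (simp add: c_def)
  qed
qed

text \<open>A nonzero entry in column \<open>c\<close> of the matrix yields a tableau with column
  word \<open>c\<close>, and its polytabloid is that column up to sign.\<close>

lemma specht_entry_in_specht: "(\<lambda>r. specht_entry p r c) \<in> specht p"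
proof (cases "\<exists>r. specht_entry p r c \<noteq> 0")
  case False
  then have "(\<lambda>r. specht_entry p r c) = 0" by (simp add: fun_eq_iff)
  then show ?thesis unfolding specht_def by (simp add: fun_space.span_zero)
next
  case True
  then obtain r where r: "specht_entry p r c \<noteq> 0" by blast
  note nz = specht_entry_nonzero[OF r]
  define T where "T = (!) (zip r c)"
  have T: "T \<in> tableaux p"
    unfolding tableaux_def T_def using nz by (auto intro!: bij_betw_nth)
  have Tw: "map T [0..<sum_list p] = zip r c"
    unfolding T_def using nz by (metis length_zip map_nth min.idem)
  then have "(\<lambda>t. specht_entry p t c) = fscale (list_sign (zip r c)) (polytabloid p T)"
    using polytabloid_eq[OF T] nz list_sign_square[of "zip r c"]
    by (simp add: fun_eq_iff fscale_def mult.assoc[symmetric])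
  then show ?thesis
    unfolding specht_def using T by (simp add: fun_space.span_scale fun_space.span_base)
qed

text \<open>No part exceeds \<open>l\<close>, so the column words of all tableaux have letters below
  \<open>l\<close>, and finitely many columns of the matrix span the module.\<close>

lemma specht_expansion:
  assumes "f \<in> specht p" and "\<forall>x\<in>set p. x \<le> l"
  shows "\<exists>z. \<forall>r. f r = (\<Sum>c\<in>words {..<l} (sum_list p). specht_entry p r c * z c)"
  using assms(1) unfolding specht_def
proof (induction rule: fun_space.span_induct_alt)
  case base
  then show ?case by (intro exI[of _ "\<lambda>_. 0"]) simp
next
  case (step k x g)
  then obtain z where z: "\<forall>r. g r = (\<Sum>c\<in>words {..<l} (sum_list p). specht_entry p r c * z c)" by blast
  obtain T where T: "T \<in> tableaux p" "x = polytabloid p T" using step by blast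
  let ?Tw = "map T [0..<sum_list p]"
  let ?c = "map snd ?Tw"
  have "snd (T i) < l" if "i < sum_list p" for i
  proof -
    have "T i \<in> diagram p" using T(1) that by (auto simp: tableaux_def bij_betw_def)
    then have "snd (T i) < p ! fst (T i)" "p ! fst (T i) \<in> set p" by (auto simp: diagram_def)
    then show ?thesis using assms(2) by fastforce
  qed
  then have "?c \<in> words {..<l} (sum_list p)" by auto
  then have "x r = (\<Sum>c\<in>words {..<l} (sum_list p). if c = ?c then list_sign ?Tw * specht_entry p r ?c else 0)" for r
    using polytabloid_eq[OF T(1)] T(2) by (simp add: sum.delta finite_words)
  then have "(fscale k x + g) r = (\<Sum>c\<in>words {..<l} (sum_list p).
      specht_entry p r c * ((if c = ?c then k * list_sign ?Tw else 0) + z c))" for r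
    using z by (auto simp: fscale_def sum_distrib_left sum.distrib[symmetric] distrib_left intro!: sum.cong)
  then show ?case
    by (intro exI[of _ "\<lambda>c. (if c = ?c then k * list_sign ?Tw else 0) + z c"] allI)
qed

section \<open>Tensor products of Specht modules\<close>

text \<open>The column with index \<open>w\<close> of the tensor product of the matrices
  \<open>specht_entry\<close>: the columns of \<open>w\<close> are the column words of the single
  factors.\<close>

definition specht_tensor :: "nat list list \<Rightarrow> nat list list \<Rightarrow> nat list list \<Rightarrow> complex" where
  "specht_tensor ps w =
     pure_tensor (map (\<lambda>j r. specht_entry (ps ! j) r (column j w)) [0..<length ps])"

lemma specht_tensor_eq:
  "specht_tensor ps w rs = (if length rs = length ps
     then \<Prod>j<length ps. specht_entry (ps ! j) (rs ! j) (column j w) else 0)"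
  by (simp add: specht_tensor_def pure_tensor_def)

lemma cnj_specht_tensor [simp]: "cnj (specht_tensor ps w rs) = specht_tensor ps w rs"
  by (simp add: specht_tensor_eq)

lemma specht_tensor_length:
  assumes "specht_tensor ps w rs \<noteq> 0" and "ps \<noteq> []" and "\<forall>p\<in>set ps. sum_list p = n"
  shows "length w = n"
proof -
  have "specht_entry (ps ! 0) (rs ! 0) (column 0 w) \<noteq> 0"
    using assms(1,2) by (auto simp: specht_tensor_eq split: if_splits)
  then show ?thesis using assms(2,3) specht_entry_nonzero(2) by fastforce
qed

text \<open>Rows are numbered below \<open>length p \<le> n\<close>, so finitely many row indices
  suffice when the transpose is applied.\<close>

lemma specht_tensor_support:
  assumes "specht_tensor ps w rs \<noteq> 0" and "\<forall>p\<in>set ps. sum_list p = n \<and> length p \<le> n"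
  shows "rs \<in> words (words {..<n} n) (length ps)"
proof -
  have len: "length rs = length ps" using assms(1) by (auto simp: specht_tensor_eq split: if_splits)
  have "rs ! j \<in> words {..<n} n" if j: "j < length ps" for j
  proof -
    have nz: "specht_entry (ps ! j) (rs ! j) (column j w) \<noteq> 0"
      using assms(1) j len by (auto simp: specht_tensor_eq)
    note e = specht_entry_nonzero[OF nz]
    have p: "sum_list (ps ! j) = n" "length (ps ! j) \<le> n" using assms(2) j by auto
    have "set (rs ! j) = fst ` set (zip (rs ! j) (column j w))"
      using e(1,2) by (metis list.set_map map_fst_zip)
    then have "set (rs ! j) \<subseteq> {..<n}" unfolding e(3) using p(2) by (auto simp: diagram_def)
    then show ?thesis using e(1) p by simp
  qed
  then show ?thesis using len by (auto simp: in_set_conv_nth subset_iff)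
qed

lemma specht_tensor_permute:
  assumes "\<pi> permutes {..<n}" and "\<forall>p\<in>set ps. sum_list p = n" and "length w = n" and "odd (length ps)"
  shows "specht_tensor ps (permute_list \<pi> w) (map (permute_list \<pi>) rs)
     = of_int (sign \<pi>) * specht_tensor ps w rs"
proof -
  have "specht_entry (ps ! j) (permute_list \<pi> (rs ! j)) (column j (permute_list \<pi> w))
      = of_int (sign \<pi>) * specht_entry (ps ! j) (rs ! j) (column j w)" if "j < length ps" for j
    using that assms specht_entry_permute[of \<pi> "ps ! j" "rs ! j" "column j w"]
    by (simp add: permute_list_column)
  moreover have "of_int (sign \<pi>) ^ length ps = (of_int (sign \<pi>) :: complex)"
    using assms(4) by (cases \<pi> rule: sign_cases) simp_all
  ultimately show ?thesis by (simp add: specht_tensor_eq prod.distrib)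
qed

lemma specht_tensor_in_tensor_space: "specht_tensor ps w \<in> tensor_space (map specht ps)"
  unfolding tensor_space_def specht_tensor_def
  by (rule fun_space.span_base) (auto simp: specht_entry_in_specht)

text \<open>Expanding every factor of a pure tensor by \<open>specht_expansion\<close> gives a
  product of sums over column words, hence a sum over words of multi-indices.\<close>

lemma tensor_space_expansion:
  assumes "x \<in> tensor_space (map specht ps)"
    and "\<forall>p\<in>set ps. sum_list p = n \<and> (\<forall>y\<in>set p. y \<le> l)"
  shows "\<exists>z. \<forall>rs. x rs = (\<Sum>w\<in>words (multi_index (length ps) l) n. specht_tensor ps w rs * z w)"
  using assms(1) unfolding tensor_space_def
proof (induction rule: fun_space.span_induct_alt)
  case base
  then show ?case by (intro exI[of _ "\<lambda>_. 0"]) simp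
next
  case (step k x g)
  let ?W = "words (multi_index (length ps) l) n"
  obtain z where z: "\<forall>rs. g rs = (\<Sum>w\<in>?W. specht_tensor ps w rs * z w)" using step by blast
  obtain fs where fs: "x = pure_tensor fs" "length fs = length ps" "\<forall>j<length ps. fs ! j \<in> specht (ps ! j)"
    using step by auto
  have "\<exists>y. \<forall>r. (fs ! j) r = (\<Sum>c\<in>words {..<l} n. specht_entry (ps ! j) r c * y c)"
    if "j < length ps" for j
  proof -
    have "ps ! j \<in> set ps" using that by simp
    then have "sum_list (ps ! j) = n" "\<forall>y\<in>set (ps ! j). y \<le> l" using assms(2) by blast+
    then show ?thesis using specht_expansion[of "fs ! j" "ps ! j" l] fs(3) that by blast
  qed
  then have "\<forall>j\<in>{..<length ps}. \<exists>y. \<forall>r. (fs ! j) r = (\<Sum>c\<in>words {..<l} n. specht_entry (ps ! j) r c * y c)"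
    by blast
  from bchoice[OF this] obtain y where y: "\<forall>j\<in>{..<length ps}. \<forall>r.
      (fs ! j) r = (\<Sum>c\<in>words {..<l} n. specht_entry (ps ! j) r c * y j c)" by blast
  have "x rs = (\<Sum>w\<in>?W. specht_tensor ps w rs * (\<Prod>j<length ps. y j (column j w)))" for rs
  proof (cases "length rs = length ps")
    case True
    then have "x rs = (\<Prod>j<length ps. \<Sum>c\<in>words {..<l} n. specht_entry (ps ! j) (rs ! j) c * y j c)"
      using fs y by (simp add: pure_tensor_def)
    also have "\<dots> = (\<Sum>w\<in>?W. \<Prod>j<length ps. specht_entry (ps ! j) (rs ! j) (column j w) * y j (column j w))"
      by (rule sum_prod_columns[symmetric])
    finally show ?thesis using True by (simp add: specht_tensor_eq prod.distrib)
  qed (use fs in \<open>simp add: pure_tensor_def specht_tensor_eq\<close>)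
  then have "(fscale k x + g) rs = (\<Sum>w\<in>?W. specht_tensor ps w rs *
      (k * (\<Prod>j<length ps. y j (column j w)) + z w))" for rs
    using z by (simp add: fscale_def sum_distrib_left sum.distrib distrib_left mult_ac)
  then show ?case
    by (intro exI[of _ "\<lambda>w. k * (\<Prod>j<length ps. y j (column j w)) + z w"] allI)
qed

text \<open>The conjugate of \<open>h\<close> is again a combination of rows, because
  \<open>M\<close> is real. Pairing it with \<open>h\<close> produces only products that vanish by
  \<open>kernel\<close>, so \<open>h\<close> has norm \<open>0\<close>.\<close>

lemma real_row_space_kernel:
  fixes M :: "'i \<Rightarrow> 'w \<Rightarrow> complex"
  assumes "finite W" and real: "\<And>i w. cnj (M i w) = M i w"
    and kernel: "\<And>i. i \<in> I \<Longrightarrow> (\<Sum>w\<in>W. M i w * h w) = 0"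
    and row: "\<And>w. w \<in> W \<Longrightarrow> h w = (\<Sum>i\<in>I. M i w * z i)"
    and "w \<in> W"
  shows "h w = 0"
proof -
  have "(\<Sum>w\<in>W. complex_of_real ((cmod (h w))\<^sup>2)) = (\<Sum>w\<in>W. h w * cnj (h w))"
    by (simp only: complex_norm_square)
  also have "\<dots> = (\<Sum>w\<in>W. h w * (\<Sum>i\<in>I. M i w * cnj (z i)))"
  proof (rule sum.cong[OF refl])
    fix w assume "w \<in> W"
    then have "cnj (h w) = (\<Sum>i\<in>I. M i w * cnj (z i))" by (simp add: row real)
    then show "h w * cnj (h w) = h w * (\<Sum>i\<in>I. M i w * cnj (z i))" by simp
  qed
  also have "\<dots> = (\<Sum>i\<in>I. cnj (z i) * (\<Sum>w\<in>W. M i w * h w))"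
    unfolding sum_distrib_left by (subst sum.swap) (simp add: mult_ac)
  also have "\<dots> = 0" using kernel by simp
  finally have "of_real (\<Sum>w\<in>W. (cmod (h w))\<^sup>2) = (0::complex)" by simp
  then have "(\<Sum>w\<in>W. (cmod (h w))\<^sup>2) = 0" by (simp only: of_real_eq_0_iff)
  then show ?thesis using assms(1,5) by (simp add: sum_nonneg_eq_0_iff)
qed

section \<open>Invariants, the transform and its adjoint\<close>

definition invariant_space :: "nat \<Rightarrow> nat list list \<Rightarrow> (nat list list \<Rightarrow> complex) set" where
  "invariant_space n ps =
     {x \<in> tensor_space (map specht ps). \<forall>\<pi>. \<pi> permutes {..<n} \<longrightarrow> diagonal_act \<pi> x = x}"

definition specht_transform ::
    "nat \<Rightarrow> nat \<Rightarrow> nat list list \<Rightarrow> (nat list list \<Rightarrow> complex) \<Rightarrow> nat list list \<Rightarrow> complex" where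
  "specht_transform n l ps f rs =
     (\<Sum>w\<in>words (multi_index (length ps) l) n. f w * specht_tensor ps w rs)"

text \<open>The transposed matrix, which is the adjoint since the entries are real. Words outside
  the basis of \<open>V\<^sub>l\<close> are not excluded.\<close>

definition specht_adjoint ::
    "nat \<Rightarrow> nat list list \<Rightarrow> (nat list list \<Rightarrow> complex) \<Rightarrow> nat list list \<Rightarrow> complex" where
  "specht_adjoint n ps x w =
     (\<Sum>rs\<in>words (words {..<n} n) (length ps). x rs * specht_tensor ps w rs)"

lemma finite_word_sets:
  "finite (words (multi_index d l) n)" "finite (words (words {..<n::nat} n) d)"
  by (intro finite_words finite_multi_index finite_lessThan)+

lemma bij_betw_map_words:
  assumes "bij_betw f A A" shows "bij_betw (map f) (words A d) (words A d)"
  using bij_lists[OF assms] unfolding bij_betw_def inj_on_def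
  by (auto simp: lists_eq_set image_iff) (metis (no_types, lifting) imageE length_map mem_Collect_eq)

lemma specht_transform_in_tensor_space:
  "specht_transform n l ps f \<in> tensor_space (map specht ps)"
proof -
  have "specht_transform n l ps f
      = (\<Sum>w\<in>words (multi_index (length ps) l) n. fscale (f w) (specht_tensor ps w))"
    by (simp add: fun_eq_iff specht_transform_def sum_fun_apply fscale_def)
  also have "\<dots> \<in> tensor_space (map specht ps)"
    using specht_tensor_in_tensor_space[of ps] unfolding tensor_space_def
    by (intro fun_space.span_sum fun_space.span_scale)
  finally show ?thesis .
qed

text \<open>Permuting entries reindexes the sum over words, and the sign of \<open>f\<close> cancels
  that of the matrix.\<close>

lemma specht_transform_invariant:
  assumes "alternating f" and "\<forall>p\<in>set ps. sum_list p = n" and "odd (length ps)"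
  shows "specht_transform n l ps f \<in> invariant_space n ps"
  unfolding invariant_space_def
proof (intro CollectI conjI allI impI ext)
  fix \<pi> rs assume \<pi>: "\<pi> permutes {..<n}"
  let ?W = "words (multi_index (length ps) l) n"
  have "diagonal_act \<pi> (specht_transform n l ps f) rs
      = (\<Sum>w\<in>?W. f (permute_list \<pi> w) * specht_tensor ps (permute_list \<pi> w) (map (permute_list \<pi>) rs))"
    unfolding diagonal_act_def specht_transform_def by (rule sum_words_permute[OF \<pi>, symmetric])
  also have "\<dots> = specht_transform n l ps f rs"
    unfolding specht_transform_def
  proof (rule sum.cong[OF refl])
    fix w assume "w \<in> ?W"
    then have "length w = n" by simp
    then have "f (permute_list \<pi> w) = of_int (sign \<pi>) * f w"
      "specht_tensor ps (permute_list \<pi> w) (map (permute_list \<pi>) rs) = of_int (sign \<pi>) * specht_tensor ps w rs"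
      using alternatingD[OF assms(1)] specht_tensor_permute[OF \<pi> assms(2) _ assms(3)] \<pi> by auto
    moreover have "of_int (sign \<pi>) * of_int (sign \<pi>) = (1::complex)"
      by (cases \<pi> rule: sign_cases) simp_all
    ultimately show "f (permute_list \<pi> w) * specht_tensor ps (permute_list \<pi> w) (map (permute_list \<pi>) rs)
        = f w * specht_tensor ps w rs"
      by (metis (no_types, opaque_lifting) mult.assoc mult.commute mult.right_neutral)
  qed
  finally show "diagonal_act \<pi> (specht_transform n l ps f) rs = specht_transform n l ps f rs" .
qed (rule specht_transform_in_tensor_space)

text \<open>Reindexing the row words by \<open>\<pi>\<close> leaves the coefficients of the
  invariant \<open>x\<close> alone and costs one sign from the matrix.\<close>

lemma alternating_specht_adjoint:
  assumes x: "x \<in> invariant_space n ps" and ps: "\<forall>p\<in>set ps. sum_list p = n" and "odd (length ps)"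
  shows "alternating (specht_adjoint n ps x)"
  unfolding alternating_def
proof (intro allI impI)
  fix w \<pi> assume \<pi>: "\<pi> permutes {..<length (w :: nat list list)}"
  have "ps \<noteq> []" using assms(3) by auto
  show "specht_adjoint n ps x (permute_list \<pi> w) = of_int (sign \<pi>) * specht_adjoint n ps x w"
  proof (cases "length w = n")
    case False
    then have "specht_tensor ps u rs = 0" if "length u = length w" for u rs
      using specht_tensor_length[OF _ \<open>ps \<noteq> []\<close> ps] that by metis
    then show ?thesis by (simp add: specht_adjoint_def)
  next
    case True
    then have \<pi>n: "\<pi> permutes {..<n}" using \<pi> by simp
    let ?R = "words (words {..<n} n) (length ps)"
    have inv: "x (map (permute_list \<pi>) rs) = x rs" for rs
      using x \<pi>n unfolding invariant_space_def diagonal_act_def fun_eq_iff by blast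
    have "specht_adjoint n ps x (permute_list \<pi> w)
        = (\<Sum>rs\<in>?R. x (map (permute_list \<pi>) rs) * specht_tensor ps (permute_list \<pi> w) (map (permute_list \<pi>) rs))"
      unfolding specht_adjoint_def
      by (rule sum.reindex_bij_betw[OF bij_betw_map_words[OF bij_betw_permute_list[OF \<pi>n]], symmetric])
    also have "\<dots> = of_int (sign \<pi>) * specht_adjoint n ps x w"
      unfolding specht_adjoint_def inv specht_tensor_permute[OF \<pi>n ps True assms(3)]
      by (simp add: sum_distrib_left mult_ac)
    finally show ?thesis .
  qed
qed

text \<open>\<open>x\<close> lies in the column space of a real matrix and is annihilated by its
  transpose.\<close>

lemma specht_adjoint_inj:
  assumes x: "x \<in> tensor_space (map specht ps)"
    and ps: "\<forall>p\<in>set ps. sum_list p = n \<and> length p \<le> n \<and> (\<forall>y\<in>set p. y \<le> l)"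
    and zero: "\<And>w. w \<in> words (multi_index (length ps) l) n \<Longrightarrow> specht_adjoint n ps x w = 0"
  shows "x = 0"
proof
  fix rs
  let ?R = "words (words {..<n} n) (length ps)" and ?W = "words (multi_index (length ps) l) n"
  have "\<exists>z. \<forall>rs. x rs = (\<Sum>w\<in>?W. specht_tensor ps w rs * z w)"
    using tensor_space_expansion[OF x] ps by simp
  then obtain z where z: "\<forall>rs. x rs = (\<Sum>w\<in>?W. specht_tensor ps w rs * z w)" by blast
  show "x rs = 0 rs"
  proof (cases "rs \<in> ?R")
    case True
    have "x rs = 0"
    proof (rule real_row_space_kernel[where W = ?R and I = ?W and M = "specht_tensor ps" and z = z])
      show "(\<Sum>rs\<in>?R. specht_tensor ps w rs * x rs) = 0" if "w \<in> ?W" for w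
        using zero[OF that] by (simp add: specht_adjoint_def mult.commute)
    qed (use z True finite_word_sets in auto)
    then show ?thesis by simp
  next
    case False
    then have "specht_tensor ps w rs = 0" for w using specht_tensor_support ps by blast
    then show ?thesis using z by simp
  qed
qed

text \<open>A letter with a coordinate at least \<open>k\<close> would place an entry in a column
  that no row of the diagram reaches.\<close>

lemma specht_adjoint_support:
  assumes "\<forall>p\<in>set ps. sum_list p = n \<and> (\<forall>y\<in>set p. y \<le> k)"
    and "\<not> set w \<subseteq> multi_index (length ps) k" and "\<forall>b\<in>set w. length b = length ps"
  shows "specht_adjoint n ps x w = 0"
proof -
  obtain b where b: "b \<in> set w" "b \<notin> multi_index (length ps) k" using assms(2) by blast
  then obtain y where "y \<in> set b" "\<not> y < k" using assms(3) by (auto simp: multi_index_def)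
  then obtain j where j: "j < length ps" "\<not> b ! j < k" using assms(3) b by (auto simp: in_set_conv_nth)
  have "specht_entry (ps ! j) r (column j w) = 0" for r
  proof (rule ccontr)
    assume "specht_entry (ps ! j) r (column j w) \<noteq> 0"
    note e = specht_entry_nonzero[OF this]
    have "b ! j \<in> set (column j w)" using b by (simp add: column_def)
    also have "set (column j w) = snd ` set (zip r (column j w))"
      using e(1,2) by (metis list.set_map map_snd_zip)
    finally have "b ! j \<in> snd ` diagram (ps ! j)" unfolding e(3) .
    then obtain a where a: "a < length (ps ! j)" "b ! j < ps ! j ! a" by (auto simp: diagram_def)
    moreover have "ps ! j \<in> set ps" "ps ! j ! a \<in> set (ps ! j)" using j a by simp_all
    ultimately have "ps ! j ! a \<le> k" using assms(1) by blast
    then show False using a j by simp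
  qed
  then have "specht_tensor ps w rs = 0" for rs
    using j(1) by (auto simp: specht_tensor_eq)
  then show ?thesis by (simp add: specht_adjoint_def)
qed

text \<open>\<open>specht_adjoint\<close> reads only one coordinate of each letter per tensor
  factor, so it need not vanish on letters that are too long. The cut-off removes them.\<close>

definition masked_adjoint ::
    "nat \<Rightarrow> nat \<Rightarrow> nat list list \<Rightarrow> (nat list list \<Rightarrow> complex) \<Rightarrow> nat list list \<Rightarrow> complex" where
  "masked_adjoint n l ps x w =
     (if set w \<subseteq> multi_index (length ps) l then specht_adjoint n ps x w else 0)"

lemma alternating_masked_adjoint:
  assumes "alternating (specht_adjoint n ps x)"
  shows "alternating (masked_adjoint n l ps x)"
  unfolding alternating_def masked_adjoint_def using alternatingD[OF assms] by simp

section \<open>The product with the Cayley form as an added first row\<close>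

definition full_masks :: "nat \<Rightarrow> nat \<Rightarrow> bool list set" where
  "full_masks l n = {bs \<in> words UNIV n. count_list bs True = l}"

text \<open>Wedging with the Cayley form adjoins a first row to the tableau in every tensor factor: the
  mask selects the entries of that row, and its shuffle sign counts the inversions between them and
  the other entries. As \<open>d\<close> is odd, the one shuffle sign in the exterior product equals the
  product of the \<open>d\<close> shuffle signs of the factors.\<close>

lemma cayley_wedge_masked_adjoint:
  assumes "odd (length ps)" and ps: "\<forall>p\<in>set ps. sum_list p = m"
    and w: "w \<in> words (multi_index (length ps) l) (l + m)"
  shows "wedge (cayley (length ps) l) (masked_adjoint m l ps x) w
     = (\<Sum>(bs, rs)\<in>full_masks l (l + m) \<times> words (words {..<m} m) (length ps).
         specht_tensor (map (rho l) ps) w (map (merge_rows bs) rs) * (fact l * x rs))"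
proof -
  let ?d = "length ps"
  let ?R = "words (words {..<m} m) ?d"
  \<comment> \<open>The words \<open>map (merge_rows bs) rs\<close> index rows of the matrix for the
    enlarged shapes, so the product becomes a combination of these rows.\<close>
  have summand: "mask_sign bs * cayley ?d l (select bs w) * masked_adjoint m l ps x (select (map Not bs) w)
      = (\<Sum>rs\<in>?R. specht_tensor (map (rho l) ps) w (map (merge_rows bs) rs) * (fact l * x rs))"
    if bs: "bs \<in> full_masks l (l + m)" for bs
  proof -
    have len: "length bs = length w" "count_list bs True = l" using bs w by (auto simp: full_masks_def)
    have sub: "set (select bs w) \<subseteq> multi_index ?d l" "set (select (map Not bs) w) \<subseteq> multi_index ?d l"
      using w set_select_subset[of bs w] set_select_subset[of "map Not bs" w] by auto
    have "mask_sign bs ^ ?d = mask_sign bs"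
      using mask_sign_cases[of bs] assms(1) by auto
    moreover have "specht_tensor (map (rho l) ps) w (map (merge_rows bs) rs)
        = (\<Prod>j<?d. mask_sign bs * levi_civita l (column j (select bs w))
            * specht_entry (ps ! j) (rs ! j) (column j (select (map Not bs) w)))"
      if rs: "rs \<in> ?R" for rs
    proof -
      have "specht_entry (map (rho l) ps ! j) (map (merge_rows bs) rs ! j) (column j w)
          = mask_sign bs * levi_civita l (column j (select bs w))
            * specht_entry (ps ! j) (rs ! j) (column j (select (map Not bs) w))" if j: "j < ?d" for j
      proof -
        have "ps ! j \<in> set ps" "rs ! j \<in> set rs" using j rs by simp_all
        then have sum: "sum_list (ps ! j) = m" "length (rs ! j) = m" using ps rs by auto
        have "specht_entry (l # (ps ! j)) (merge_rows bs (rs ! j)) (column j w)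
            = mask_sign bs * levi_civita l (select bs (column j w))
              * specht_entry (ps ! j) (rs ! j) (select (map Not bs) (column j w))"
          using len w sum by (intro specht_entry_merge_rows) simp_all
        then show ?thesis using j rs by (simp add: rho_def column_select)
      qed
      then show ?thesis using rs by (simp add: specht_tensor_eq)
    qed
    ultimately have "(\<Sum>rs\<in>?R. specht_tensor (map (rho l) ps) w (map (merge_rows bs) rs) * (fact l * x rs))
        = (\<Sum>rs\<in>?R. mask_sign bs * (fact l * (\<Prod>j<?d. levi_civita l (column j (select bs w)))) *
            (x rs * (\<Prod>j<?d. specht_entry (ps ! j) (rs ! j) (column j (select (map Not bs) w)))))"
      by (intro sum.cong) (simp_all add: prod.distrib mult_ac)
    also have "\<dots> = mask_sign bs * cayley ?d l (select bs w) * masked_adjoint m l ps x (select (map Not bs) w)"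
      using sub assms(1)
      by (simp add: cayley_eq masked_adjoint_def specht_adjoint_def specht_tensor_eq sum_distrib_left)
    finally show ?thesis ..
  qed
  have "wedge (cayley ?d l) (masked_adjoint m l ps x) w = (\<Sum>bs\<in>words UNIV (l + m).
      mask_sign bs * cayley ?d l (select bs w) * masked_adjoint m l ps x (select (map Not bs) w))"
    using w by (simp add: wedge_masks)
  \<comment> \<open>The Cayley form lives in degree \<open>l\<close>, so only masks with
    \<open>l\<close> marks contribute.\<close>
  also have "\<dots> = (\<Sum>bs\<in>full_masks l (l + m).
      mask_sign bs * cayley ?d l (select bs w) * masked_adjoint m l ps x (select (map Not bs) w))"
  proof (rule sum.mono_neutral_right)
    show "finite (words (UNIV :: bool set) (l + m))" by (rule finite_words) simp
    show "\<forall>bs\<in>words UNIV (l + m) - full_masks l (l + m). mask_sign bs * cayley ?d l (select bs w)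
        * masked_adjoint m l ps x (select (map Not bs) w) = 0"
    proof
      fix bs assume "bs \<in> words UNIV (l + m) - full_masks l (l + m)"
      then have "length (select bs w) \<noteq> l" using w by (auto simp: full_masks_def length_select)
      moreover have "0 < ?d" using assms(1) by (cases ps) auto
      ultimately have "cayley ?d l (select bs w) = 0"
        using assms(1) by (auto simp: cayley_eq levi_civita_def)
      then show "mask_sign bs * cayley ?d l (select bs w) * masked_adjoint m l ps x (select (map Not bs) w) = 0"
        by simp
    qed
  qed (auto simp: full_masks_def)
  also have "\<dots> = (\<Sum>bs\<in>full_masks l (l + m). \<Sum>rs\<in>?R.
      specht_tensor (map (rho l) ps) w (map (merge_rows bs) rs) * (fact l * x rs))"
    using summand by (rule sum.cong[OF refl])
  also have "\<dots> = (\<Sum>(bs, rs)\<in>full_masks l (l + m) \<times> ?R.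
      specht_tensor (map (rho l) ps) w (map (merge_rows bs) rs) * (fact l * x rs))"
    by (rule sum.cartesian_product)
  finally show ?thesis .
qed

text \<open>The map between spaces of invariants whose injectivity yields the inequality of
  Kronecker coefficients.\<close>

definition add_row :: "nat \<Rightarrow> nat \<Rightarrow> nat list list \<Rightarrow> (nat list list \<Rightarrow> complex) \<Rightarrow> nat list list \<Rightarrow> complex" where
  "add_row m l ps x = specht_transform (l + m) l (map (rho l) ps)
     (wedge (cayley (length ps) l) (masked_adjoint m l ps x))"

lemma add_row_invariant:
  assumes "x \<in> invariant_space m ps" and "odd (length ps)" and "\<forall>p\<in>set ps. sum_list p = m"
  shows "add_row m l ps x \<in> invariant_space (l + m) (map (rho l) ps)"
  unfolding add_row_def
proof (rule specht_transform_invariant)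
  have "alternating (cayley (length ps) l)"
    using cayley_in_ext_alg[OF assms(2)] by (simp add: ext_alg_iff)
  then show "alternating (wedge (cayley (length ps) l) (masked_adjoint m l ps x))"
    using alternating_specht_adjoint[OF assms(1,3,2)]
    by (intro alternating_wedge alternating_masked_adjoint)
qed (use assms in \<open>auto simp: rho_def\<close>)

text \<open>The three steps are undone from the outside: the wedge product lies in the row space and
  the kernel of the outer matrix, the word \<open>w\<close> extracts the masked adjoint from it, and
  the adjoint is injective.\<close>

lemma add_row_inj:
  assumes x: "x \<in> invariant_space m ps" and d: "odd (length ps)" "length ps \<ge> 3" and "l > 2"
    and ps: "\<forall>p\<in>set ps. sum_list p = m \<and> length p \<le> m \<and> (\<forall>y\<in>set p. y \<le> 2)"
    and zero: "add_row m l ps x = 0"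
  shows "x = 0"
proof -
  let ?d = "length ps"
  let ?v = "masked_adjoint m l ps x" and ?W = "words (multi_index ?d l) (l + m)"
  let ?I = "full_masks l (l + m) \<times> words (words {..<m} m) ?d"
  \<comment> \<open>The rows used are those at merged row words; evaluating \<open>zero\<close>
    there gives the kernel condition.\<close>
  have wedge_zero: "wedge (cayley ?d l) ?v w = 0" if "w \<in> ?W" for w
  proof (rule real_row_space_kernel[where W = ?W and I = ?I
        and M = "\<lambda>(bs, rs) w. specht_tensor (map (rho l) ps) w (map (merge_rows bs) rs)"
        and z = "\<lambda>(bs, rs). fact l * x rs"])
    show "(\<Sum>w\<in>?W. (case i of (bs, rs) \<Rightarrow> \<lambda>w. specht_tensor (map (rho l) ps) w (map (merge_rows bs) rs)) w
        * wedge (cayley ?d l) ?v w) = 0" for i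
    proof (cases i)
      case (Pair bs rs)
      have "add_row m l ps x (map (merge_rows bs) rs) = 0" by (simp add: zero)
      then show ?thesis by (simp add: Pair add_row_def specht_transform_def mult.commute)
    qed
    show "wedge (cayley ?d l) ?v w = (\<Sum>i\<in>?I.
        (case i of (bs, rs) \<Rightarrow> \<lambda>w. specht_tensor (map (rho l) ps) w (map (merge_rows bs) rs)) w
        * (case i of (bs, rs) \<Rightarrow> fact l * x rs))" if "w \<in> ?W" for w
      using cayley_wedge_masked_adjoint[OF d(1) _ that] ps by (simp add: split_def)
  qed (use that finite_word_sets in \<open>auto simp: split_def\<close>)
  have support: "?v u = 0" if "\<not> set u \<subseteq> multi_index ?d 2" for u
  proof (cases "set u \<subseteq> multi_index ?d l")
    case True
    then have "\<forall>b\<in>set u. length b = ?d" by (auto simp: multi_index_def)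
    then show ?thesis
      using specht_adjoint_support[of ps m 2 u x] that ps by (simp add: masked_adjoint_def)
  qed (simp add: masked_adjoint_def)
  obtain w where w: "w \<in> words (multi_index ?d l) l" "cayley ?d l w \<noteq> 0"
    and "\<forall>v. (\<forall>u. \<not> set u \<subseteq> multi_index ?d 2 \<longrightarrow> v u = 0) \<longrightarrow>
      (\<forall>u. wedge (cayley ?d l) v (w @ u) = cayley ?d l w * v u)"
    by (rule cayley_wedge_word[OF d \<open>l > 2\<close>])
  then have wedge: "wedge (cayley ?d l) ?v (w @ u) = cayley ?d l w * ?v u" for u
    using support by blast
  show ?thesis
  proof (rule specht_adjoint_inj)
    show "x \<in> tensor_space (map specht ps)" using x by (simp add: invariant_space_def)
    show "\<forall>p\<in>set ps. sum_list p = m \<and> length p \<le> m \<and> (\<forall>y\<in>set p. y \<le> l)"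
      using ps \<open>l > 2\<close> by fastforce
    fix u assume u: "u \<in> words (multi_index ?d l) m"
    then have "w @ u \<in> ?W" using w by simp
    then have "cayley ?d l w * ?v u = 0" using wedge_zero wedge by metis
    then show "specht_adjoint m ps x u = 0" using w(2) u by (simp add: masked_adjoint_def)
  qed
qed

lemma wedge_add_right: "wedge f (\<lambda>u. g u + h u) w = wedge f g w + wedge f h w"
  unfolding wedge_def by (simp add: sum.distrib algebra_simps)

lemma linear_add_row: "Vector_Spaces.linear fscale fscale (add_row m l ps)"
proof -
  have add: "masked_adjoint m l ps (x + y) = (\<lambda>w. masked_adjoint m l ps x w + masked_adjoint m l ps y w)" for x y
    by (simp add: fun_eq_iff masked_adjoint_def specht_adjoint_def sum.distrib distrib_right)
  have scale: "masked_adjoint m l ps (fscale c x) = (\<lambda>w. c * masked_adjoint m l ps x w)" for c x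
    by (simp add: fun_eq_iff masked_adjoint_def specht_adjoint_def fscale_def sum_distrib_left mult.assoc)
  have "add_row m l ps (x + y) = add_row m l ps x + add_row m l ps y" for x y
    unfolding add_row_def add
    by (simp add: fun_eq_iff specht_transform_def wedge_add_right sum.distrib distrib_right)
  moreover have "add_row m l ps (fscale c x) = fscale c (add_row m l ps x)" for c x
    unfolding add_row_def scale
    by (simp add: fun_eq_iff specht_transform_def wedge_scale_right fscale_def sum_distrib_left mult.assoc)
  ultimately show ?thesis by unfold_locales
qed


section \<open>Kronecker coefficients as dimensions of spaces of invariants\<close>

text \<open>In a single row all entries have different columns, so the column stabilizer is trivial,
  and there is only one tabloid.\<close>

lemma specht_one_row:
  "specht (one_row n) = range (\<lambda>c. fscale c (delta (replicate n 0)))"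
proof -
  have sum: "sum_list (one_row n) = n" by (simp add: one_row_def)
  have diag: "diagram (one_row n) = {0} \<times> {..<n}" by (auto simp: diagram_def one_row_def)
  have poly: "polytabloid (one_row n) T = delta (replicate n 0)" if "T \<in> tableaux (one_row n)" for T
  proof -
    have T: "bij_betw T {..<n} ({0} \<times> {..<n})" using that by (simp add: tableaux_def sum diag)
    have fst: "fst (T k) = 0" if "k < n" for k using bspec[OF bij_betwE[OF T], of k] that by auto
    have "column_stabilizer (one_row n) T = {id}"
    proof (intro equalityI subsetI)
      fix \<sigma> assume "\<sigma> \<in> column_stabilizer (one_row n) T"
      then have \<sigma>: "\<sigma> permutes {..<n}" "\<And>k. k < n \<Longrightarrow> snd (T (\<sigma> k)) = snd (T k)"
        by (simp_all add: column_stabilizer_def sum)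
      have "\<sigma> k = k" for k
      proof (cases "k < n")
        case True
        then have k: "\<sigma> k < n" using permutes_in_image[OF \<sigma>(1), of k] by simp
        then have "T (\<sigma> k) = T k" using \<sigma>(2) fst True by (simp add: prod_eq_iff)
        then show ?thesis using T k True by (auto simp: bij_betw_def dest: inj_onD)
      qed (use \<sigma>(1) in \<open>simp add: permutes_not_in\<close>)
      then show "\<sigma> \<in> {id}" by auto
    qed (simp add: column_stabilizer_def permutes_id)
    moreover have "tabloid (one_row n) T = replicate n 0"
      by (rule nth_equalityI) (auto simp: tabloid_def sum fst)
    ultimately show ?thesis
      by (simp add: polytabloid_def fscale_def tabloid_act_def fun_eq_iff)
  qed
  have "(\<lambda>k. (0, k)) \<in> tableaux (one_row n)"
    by (auto simp: tableaux_def sum diag bij_betw_def inj_on_def)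
  then have "polytabloid (one_row n) ` tableaux (one_row n) = {delta (replicate n 0)}"
    using poly by (force simp: image_iff)
  then show ?thesis by (simp add: specht_def fun_space.span_singleton)
qed

text \<open>The linear map that sends the generator \<open>delta (replicate n 0)\<close> to
  \<open>x\<close>, with the value \<open>0\<close> off the module that
  \<open>equivariant_maps\<close> requires.\<close>

definition trivial_map ::
    "nat \<Rightarrow> ('b \<Rightarrow> complex) \<Rightarrow> (nat list \<Rightarrow> complex) \<Rightarrow> 'b \<Rightarrow> complex" where
  "trivial_map n x = (\<lambda>y. if y \<in> specht (one_row n) then fscale (y (replicate n 0)) x else 0)"

lemma linear_trivial_map: "Vector_Spaces.linear fscale mscale (trivial_map n)"
  by unfold_locales (auto simp: trivial_map_def mscale_def fscale_def fun_eq_iff algebra_simps)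

lemma tabloid_act_one_row:
  assumes "\<pi> permutes {..<n}" and "y \<in> specht (one_row n)"
  shows "tabloid_act \<pi> y = y"
proof -
  obtain c where y: "y = fscale c (delta (replicate n 0))" using assms(2) specht_one_row by blast
  have rep: "t = replicate n 0 \<longleftrightarrow> length t = n \<and> set t \<subseteq> {0}" for t :: "nat list"
    by (auto intro: replicate_eqI)
  have "permute_list \<pi> t = replicate n 0 \<longleftrightarrow> t = replicate n 0" for t :: "nat list"
  proof (cases "length t = n")
    case True
    then have "set (permute_list \<pi> t) = set t" using assms(1) by simp
    then show ?thesis by (simp only: rep length_permute_list)
  next
    case False
    then show ?thesis by (metis length_permute_list length_replicate)
  qed
  then show ?thesis by (simp add: y tabloid_act_def fscale_def delta_def fun_eq_iff)
qed

text \<open>A map out of a line is determined by the image of a generator. The group acts trivially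
  on this line, so equivariance says that the image is invariant.\<close>

lemma equivariant_maps_trivial:
  "equivariant_maps n (specht (one_row n)) tabloid_act (tensor_space (map specht ps)) diagonal_act
     = trivial_map n ` invariant_space n ps"
proof (intro equalityI subsetI)
  let ?W = "specht (one_row n)" and ?X = "tensor_space (map specht ps)" and ?e = "delta (replicate n 0) :: nat list \<Rightarrow> complex"
  have e: "?e \<in> ?W" unfolding specht_one_row by (rule range_eqI[of _ _ 1]) (simp add: fscale_def)
  fix F
  {
    assume F: "F \<in> equivariant_maps n ?W tabloid_act ?X diagonal_act"
    then have scale: "\<And>c y. y \<in> ?W \<Longrightarrow> F (fscale c y) = fscale c (F y)"
      and out: "\<And>y. y \<notin> ?W \<Longrightarrow> F y = 0"
      and equi: "\<And>\<pi> y. \<pi> permutes {..<n} \<Longrightarrow> y \<in> ?W \<Longrightarrow> F (tabloid_act \<pi> y) = diagonal_act \<pi> (F y)"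
      and into: "\<And>y. y \<in> ?W \<Longrightarrow> F y \<in> ?X"
      unfolding equivariant_maps_def by simp_all
    have "F y = trivial_map n (F ?e) y" for y
    proof (cases "y \<in> ?W")
      case True
      then obtain c where y: "y = fscale c ?e" using specht_one_row by blast
      then have "y (replicate n 0) = c" by (simp add: fscale_def delta_def)
      then show ?thesis using True scale[OF e, of c] y by (simp add: trivial_map_def)
    qed (simp add: out trivial_map_def)
    then have "F = trivial_map n (F ?e)" by (rule ext)
    moreover have "F ?e \<in> invariant_space n ps"
      unfolding invariant_space_def
      using into[OF e] equi[OF _ e] tabloid_act_one_row[OF _ e] by simp
    ultimately show "F \<in> trivial_map n ` invariant_space n ps" by blast
  next
    assume "F \<in> trivial_map n ` invariant_space n ps"
    then obtain x where x: "x \<in> ?X" "\<And>\<pi>. \<pi> permutes {..<n} \<Longrightarrow> diagonal_act \<pi> x = x"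
      and F: "F = trivial_map n x" unfolding invariant_space_def by blast
    have add: "y + z \<in> ?W" if "y \<in> ?W" "z \<in> ?W" for y z
      using that unfolding specht_def by (rule fun_space.span_add)
    have scale: "fscale c y \<in> ?W" if "y \<in> ?W" for c y
      using that unfolding specht_def by (rule fun_space.span_scale)
    have xscale: "fscale c x \<in> ?X" for c
      using x(1) unfolding tensor_space_def by (rule fun_space.span_scale)
    have xact: "diagonal_act \<pi> (fscale c x) = fscale c x" if "\<pi> permutes {..<n}" for c \<pi>
      using x(2)[OF that] by (simp add: diagonal_act_def fscale_def fun_eq_iff)
    have "F (y + z) = F y + F z" if "y \<in> ?W" "z \<in> ?W" for y z
      using that add[OF that] by (simp add: F trivial_map_def fun_space.scale_left_distrib)
    moreover have "F (fscale c y) = fscale c (F y)" if "y \<in> ?W" for c y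
      using that scale[OF that] by (simp add: F trivial_map_def) (simp add: fscale_def mult.assoc)
    moreover have "F (tabloid_act \<pi> y) = diagonal_act \<pi> (F y)" if "\<pi> permutes {..<n}" "y \<in> ?W" for \<pi> y
      using that by (simp add: tabloid_act_one_row F trivial_map_def xact)
    ultimately show "F \<in> equivariant_maps n ?W tabloid_act ?X diagonal_act"
      unfolding equivariant_maps_def using xscale by (simp add: F trivial_map_def)
  }
qed

lemma subspace_invariant_space: "fun_space.subspace (invariant_space n ps)"
proof (unfold fun_space.subspace_def, intro conjI ballI allI)
  have act: "diagonal_act \<pi> 0 = 0" "diagonal_act \<pi> (x + y) = diagonal_act \<pi> x + diagonal_act \<pi> y"
    "diagonal_act \<pi> (fscale c x) = fscale c (diagonal_act \<pi> x)" for \<pi> x y c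
    by (simp_all add: diagonal_act_def fscale_def fun_eq_iff)
  show "0 \<in> invariant_space n ps"
    unfolding invariant_space_def tensor_space_def by (simp add: act fun_space.span_zero)
  show "x + y \<in> invariant_space n ps" if "x \<in> invariant_space n ps" "y \<in> invariant_space n ps" for x y
    using that unfolding invariant_space_def tensor_space_def by (simp add: act fun_space.span_add)
  show "fscale c x \<in> invariant_space n ps" if "x \<in> invariant_space n ps" for c x
    using that unfolding invariant_space_def tensor_space_def by (simp add: act fun_space.span_scale)
qed

text \<open>A basis of \<open>S\<close> is carried to a basis of the image. The two scalings may
  differ, as for functions and for maps.\<close>

lemma (in vector_space_pair) dim_linear_image:
  assumes lin: "Vector_Spaces.linear s1 s2 f" and inj: "inj_on f (vs1.span S)"
  shows "vs2.dim (f ` S) = vs1.dim S"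
proof -
  interpret lin: Vector_Spaces.linear s1 s2 f by (rule lin)
  obtain B where B: "B \<subseteq> S" "vs1.independent B" "S \<subseteq> vs1.span B" "card B = vs1.dim S"
    by (rule vs1.basis_exists)
  have BS: "vs1.span B \<subseteq> vs1.span S" using B(1) by (rule vs1.span_mono)
  then have "vs2.independent (f ` B)"
    using inj by (intro lin.independent_injective_image[OF B(2)]) (rule inj_on_subset)
  moreover have "f ` S \<subseteq> vs2.span (f ` B)" using B(3) lin.span_image[of B] by blast
  ultimately have "card (f ` B) = vs2.dim (f ` S)" using B(1) by (intro vs2.basis_card_eq_dim) blast+
  moreover have "card (f ` B) = card B"
    using inj BS vs1.span_superset[of B] by (intro card_image) (blast intro: inj_on_subset)
  ultimately show ?thesis using B(4) by simp
qed

lemma kronecker_eq_dim: "kronecker n ps = fun_space.dim (invariant_space n ps)"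
proof -
  interpret vector_space_pair "fscale :: complex \<Rightarrow> (nat list list \<Rightarrow> complex) \<Rightarrow> _"
    "mscale :: complex \<Rightarrow> ((nat list \<Rightarrow> complex) \<Rightarrow> nat list list \<Rightarrow> complex) \<Rightarrow> _"
    by unfold_locales
  have "inj (trivial_map n :: (nat list list \<Rightarrow> complex) \<Rightarrow> _)"
  proof (rule injI)
    fix x y :: "nat list list \<Rightarrow> complex" assume eq: "trivial_map n x = trivial_map n y"
    have "delta (replicate n 0) \<in> specht (one_row n)"
      unfolding specht_one_row by (rule range_eqI[of _ _ 1]) (simp add: fscale_def)
    then have "trivial_map n x (delta (replicate n 0)) = x" for x :: "nat list list \<Rightarrow> complex"
      by (simp add: trivial_map_def fscale_def delta_def)
    then show "x = y" using eq by metis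
  qed
  then have "inj_on (trivial_map n) (fun_space.span (invariant_space n ps))"
    by (rule inj_on_subset) simp
  then show ?thesis
    unfolding kronecker_def multiplicity_in_def equivariant_maps_trivial
    by (rule dim_linear_image[OF linear_trivial_map])
qed

text \<open>An infinite basis counts as dimension \<open>0\<close>, so \<open>W\<close> is confined
  to the span of a finite set.\<close>

lemma (in vector_space) dim_mono_span:
  assumes "V \<subseteq> W" and "W \<subseteq> span T" and "finite T"
  shows "dim V \<le> dim W"
proof -
  obtain B where B: "B \<subseteq> W" "independent B" "W \<subseteq> span B" "card B = dim W"
    by (rule basis_exists)
  have "finite B" using independent_span_bound[OF assms(3) B(2)] B(1) assms(2) by blast
  then show ?thesis using dim_le_card[of V B] B assms(1) by auto
qed

text \<open>\<open>add_row\<close> embeds the invariants for \<open>ps\<close> into those for the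
  enlarged shapes.\<close>

lemma kronecker_le_add_row:
  assumes d: "odd (length ps)" "length ps \<ge> 3" and "l > 2"
    and ps: "\<forall>p\<in>set ps. sum_list p = m \<and> length p \<le> m \<and> (\<forall>y\<in>set p. y \<le> 2)"
  shows "kronecker m ps \<le> kronecker (l + m) (map (rho l) ps)"
proof -
  interpret vector_space_pair "fscale :: complex \<Rightarrow> (nat list list \<Rightarrow> complex) \<Rightarrow> _"
    "fscale :: complex \<Rightarrow> (nat list list \<Rightarrow> complex) \<Rightarrow> _"
    by unfold_locales
  let ?V = "invariant_space m ps" and ?V' = "invariant_space (l + m) (map (rho l) ps)"
  have span: "fun_space.span ?V = ?V" by (simp add: fun_space.span_eq_iff subspace_invariant_space)
  have lin: "Vector_Spaces.linear fscale fscale (add_row m l ps)" by (rule linear_add_row)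
  have "inj_on (add_row m l ps) ?V"
  proof (rule inj_onI)
    fix x y assume "x \<in> ?V" "y \<in> ?V" "add_row m l ps x = add_row m l ps y"
    then have "x - y \<in> ?V" "add_row m l ps (x - y) = 0"
      using fun_space.subspace_diff[OF subspace_invariant_space] linear_diff[OF lin] by auto
    then have "x - y = 0" using add_row_inj[OF _ d \<open>l > 2\<close> ps] by blast
    then show "x = y" by simp
  qed
  then have "fun_space.dim (add_row m l ps ` ?V) = fun_space.dim ?V"
    by (intro dim_linear_image[OF lin]) (simp only: span)
  moreover have "fun_space.dim (add_row m l ps ` ?V) \<le> fun_space.dim ?V'"
  proof (rule fun_space.dim_mono_span)
    show "add_row m l ps ` ?V \<subseteq> ?V'" using add_row_invariant[OF _ d(1)] ps by auto
    let ?W = "words (multi_index (length (map (rho l) ps)) l) (l + m)"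
    show "finite (specht_tensor (map (rho l) ps) ` ?W)"
      by (intro finite_imageI finite_word_sets)
    \<comment> \<open>With the new row, \<open>l\<close> is the largest part, so column words with
      letters below \<open>l\<close> suffice.\<close>
    show "?V' \<subseteq> fun_space.span (specht_tensor (map (rho l) ps) ` ?W)"
    proof
      fix x assume "x \<in> ?V'"
      then have "x \<in> tensor_space (map specht (map (rho l) ps))" by (simp add: invariant_space_def)
      moreover have "\<forall>p\<in>set (map (rho l) ps). sum_list p = l + m \<and> (\<forall>y\<in>set p. y \<le> l)"
        using ps \<open>l > 2\<close> by (fastforce simp: rho_def)
      ultimately obtain z where "\<forall>rs. x rs = (\<Sum>w\<in>?W. specht_tensor (map (rho l) ps) w rs * z w)"
        using tensor_space_expansion by blast
      then have "x = (\<Sum>w\<in>?W. fscale (z w) (specht_tensor (map (rho l) ps) w))"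
        by (simp add: fun_eq_iff sum_fun_apply fscale_def mult.commute)
      also have "\<dots> \<in> fun_space.span (specht_tensor (map (rho l) ps) ` ?W)"
        by (intro fun_space.span_sum fun_space.span_scale fun_space.span_base) blast
      finally show "x \<in> fun_space.span (specht_tensor (map (rho l) ps) ` ?W)" .
    qed
  qed
  ultimately show ?thesis by (simp add: kronecker_eq_dim)
qed

section \<open>Specialisation to partitions with parts at most two\<close>

lemma length_partition_le: "is_partition n p \<Longrightarrow> length p \<le> n"
proof -
  have "0 \<notin> set p \<Longrightarrow> length p \<le> sum_list p" for p :: "nat list" by (induction p) auto
  then show "is_partition n p \<Longrightarrow> length p \<le> n" by (auto simp: is_partition_def)
qed

theorem corollary1p11:
  fixes d m l :: nat and lam :: "nat list list"
  assumes "d \<ge> 3" and "odd d"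
    and "length lam = d"
    and "\<forall>p\<in>set lam. is_partition m p"
    and "m \<le> 2 ^ (d - 1)"
    and "\<forall>p\<in>set lam. \<forall>x\<in>set p. x \<le> 2"
    and "l > 2"
  shows "(\<lambda>v. wedge (cayley d l) v)
           \<in> HWV d l (weight_of (map conj_partition lam))
             \<rightarrow> HWV d l (weight_of (map conj_partition (map (rho l) lam)))
       \<and> inj_on (\<lambda>v. wedge (cayley d l) v) (HWV d l (weight_of (map conj_partition lam)))
       \<and> kronecker m lam \<le> kronecker (m + l) (map (rho l) lam)"
proof (intro conjI)
  have part: "sorted_wrt (\<ge>) (lam ! j)" "\<forall>x\<in>set (lam ! j). x \<le> 2" if "j < d" for j
  proof -
    have "lam ! j \<in> set lam" using that assms(3) by simp
    then show "sorted_wrt (\<ge>) (lam ! j)" "\<forall>x\<in>set (lam ! j). x \<le> 2"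
      using assms(4,6) unfolding is_partition_def by blast+
  qed
  have "weight_of (map conj_partition (map (rho l) lam)) j i = weight_of (map conj_partition lam) j i + 1"
    if "j < d" "i < l" for j i
    using part[OF \<open>j < d\<close>] that assms(3,7) by (intro weight_of_conj_rho) fastforce+
  then show "(\<lambda>v. wedge (cayley d l) v) \<in> HWV d l (weight_of (map conj_partition lam))
      \<rightarrow> HWV d l (weight_of (map conj_partition (map (rho l) lam)))"
    using cayley_wedge_HWV[OF assms(2)] by blast
  \<comment> \<open>Parts are at most \<open>2\<close>, so the conjugates have at most two parts,
    and the weight vanishes from coordinate \<open>2\<close> on.\<close>
  have "weight_of (map conj_partition lam) j i = 0" if "j < d" "i \<ge> 2" for j i
  proof -
    have "filter (\<lambda>x. i < x) (lam ! j) = []" using part[OF that(1)] that(2) by (fastforce simp: filter_empty_conv)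
    then show ?thesis using weight_of_conj[of j lam i] part[OF that(1)] that(1) assms(3) by simp
  qed
  then show "inj_on (\<lambda>v. wedge (cayley d l) v) (HWV d l (weight_of (map conj_partition lam)))"
    using assms by (intro cayley_wedge_inj_on_HWV)
  have "\<forall>p\<in>set lam. sum_list p = m \<and> length p \<le> m \<and> (\<forall>y\<in>set p. y \<le> 2)"
    using assms(4,6) length_partition_le by (auto simp: is_partition_def)
  then show "kronecker m lam \<le> kronecker (m + l) (map (rho l) lam)"
    using kronecker_le_add_row[of lam l m] assms by (simp add: add.commute)
qed

end
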